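(* Let $n\ge 2$ and let $\Omega\subset\mathbb R^n$ be a bounded open set containing the origin $0$. Assume that $u\in C^0(\Omega\setminus\{0\})$, that $v$ is $C^1$ in some open neighborhood of $\overline\Omega$, and that $$v>0\ \text{ in }\overline\Omega,\qquad \Delta u\le 0\ \text{ in }\Omega\setminus\{0\},\qquad u\ge v\ \text{ in }\Omega\setminus\{0\}.$$ Assume also that $\varphi,\xi,\psi$ are $C^1$ functions near $1$ satisfying $\varphi(1)=\xi(1)=1$, $\psi(1)=0$, $\varphi'(1)+\xi'(1)>0$, and $$\varphi'(1)v(y)+\xi'(1)\nabla v(y)\cdot y+\psi'(1)>0,\qquad\forall y\in\overline\Omega .$$ Let $$\Phi(v,x,\lambda;y):=\varphi(\lambda)\,v(x+\xi(\lambda)y)+\psi(\lambda),$$ and assume that there exists some $\epsilon_4>0$ such that for any $|x|<\epsilon_4$ and $|\lambda-1|<\epsilon_4$, $$\inf_{\Omega\setminus\{0\}}\left[u-\Phi(v,x,\lambda;\cdot)\right]=0\quad\text{implies}\quad\liminf_{|y|\to 0}\left[u(y)-\Phi(v,x,\lambda;y)\right]=0 .$$ Then either $$\liminf_{|x|\to 0}[u(x)-v(x)]>0$$ or $u=v=v(0)$ near the origin.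
   Context: Since $u$ is only assumed continuous, $\Delta u\le 0$ is understood in the distribution sense. *)

theory Defs
  imports "HOL-Analysis.Analysis"
begin

definition partial :: "'a::euclidean_space \<Rightarrow> ('a \<Rightarrow> real) \<Rightarrow> 'a \<Rightarrow> real" where
  "partial b f x = frechet_derivative f (at x) b"

definition gradient :: "('a::euclidean_space \<Rightarrow> real) \<Rightarrow> 'a \<Rightarrow> 'a" where
  "gradient f x = (\<Sum>b\<in>Basis. partial b f x *\<^sub>R b)"

definition laplacian :: "('a::euclidean_space \<Rightarrow> real) \<Rightarrow> 'a \<Rightarrow> real" where
  "laplacian f x = (\<Sum>b\<in>Basis. partial b (partial b f) x)"

text \<open>Only meant for open sets \<open>S\<close>, since the derivatives are two-sided.\<close>

primrec Ck_on :: "nat \<Rightarrow> ('a::euclidean_space \<Rightarrow> real) \<Rightarrow> 'a set \<Rightarrow> bool" where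
  "Ck_on 0 f S \<longleftrightarrow> continuous_on S f"
| "Ck_on (Suc k) f S \<longleftrightarrow>
     (\<forall>x\<in>S. f differentiable (at x)) \<and> (\<forall>b\<in>Basis. Ck_on k (partial b f) S)"

definition test_function_on :: "'a::euclidean_space set \<Rightarrow> ('a \<Rightarrow> real) \<Rightarrow> bool" where
  "test_function_on S \<eta> \<longleftrightarrow>
     (\<forall>k. Ck_on k \<eta> UNIV) \<and>
     compact (closure {x. \<eta> x \<noteq> 0}) \<and> closure {x. \<eta> x \<noteq> 0} \<subseteq> S"

text \<open>
  \<open>\<Delta> u \<le> 0\<close> on the open set \<open>S\<close> in the sense of distributions. The integrand is
  integrable whenever \<open>u\<close> is locally integrable on \<open>S\<close>, in particular whenever \<open>u\<close> is
  continuous on \<open>S\<close>; for other \<open>u\<close> the Bochner integral may default to \<open>0\<close>.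
\<close>

definition laplacian_nonpos_distr_on :: "('a::euclidean_space \<Rightarrow> real) \<Rightarrow> 'a set \<Rightarrow> bool" where
  "laplacian_nonpos_distr_on u S \<longleftrightarrow>
     (\<forall>\<eta>. test_function_on S \<eta> \<and> (\<forall>x. 0 \<le> \<eta> x) \<longrightarrow>
        (LINT x:S|lborel. u x * laplacian \<eta> x) \<le> 0)"

definition Phi ::
    "(real \<Rightarrow> real) \<Rightarrow> (real \<Rightarrow> real) \<Rightarrow> (real \<Rightarrow> real) \<Rightarrow>
     ('a::real_vector \<Rightarrow> real) \<Rightarrow> 'a \<Rightarrow> real \<Rightarrow> 'a \<Rightarrow> real" where
  "Phi \<phi> \<xi> \<psi> v x lam y = \<phi> lam * v (x + \<xi> lam *\<^sub>R y) + \<psi> lam"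

end

theory Submission
  imports Defs
begin

text \<open>
  Suppose the lower limit of \<open>u - v\<close> at the origin is not positive; since \<open>u \<ge> v\<close> it is then zero,
  and \<open>v 0\<close> is the lower limit of \<open>u\<close>. The hypothesis on the derivatives at \<open>1\<close> says that
  \<open>\<lambda> \<mapsto> \<Phi>(v, x, \<lambda>; y)\<close> is strictly increasing near \<open>\<lambda> = 1\<close>, uniformly in small \<open>x\<close> and in
  \<open>y \<in> closure \<Omega>\<close>. For each small \<open>x\<close> one can therefore raise \<open>\<lambda>\<close> up to a last value \<open>\<lambda>(x)\<close>,
  close to \<open>1\<close>, for which \<open>\<Phi>(v, x, \<lambda>(x); \<cdot>)\<close> still lies below \<open>u\<close>
  (\<open>maximal_parameter_below\<close>). The infimum of the difference is then zero, so by the touching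
  hypothesis contact takes place at the origin: \<open>\<Phi>(v, x, \<lambda>(x); 0) = v 0\<close>.

  Now \<open>u\<close> lies above two \<open>C\<^sup>1\<close> functions, \<open>\<Phi>(v, x, \<lambda>(x); \<cdot>)\<close> and \<open>v\<close>, and all three have the same
  lower limit at \<open>0\<close>. A superharmonic function on a punctured ball cannot tolerate a convex corner
  below it at the puncture (\<open>supporting_gradient_unique\<close>), hence the two gradients agree:
  \<open>\<phi>(\<lambda>(x)) \<xi>(\<lambda>(x)) \<nabla>v(x) = \<nabla>v(0)\<close> for all small \<open>x\<close>. Write \<open>p\<close> for \<open>\<nabla>v(0)\<close>. Where \<open>v\<close> exceeds
  \<open>v 0\<close> the parameter \<open>\<lambda>(x)\<close> is below \<open>1\<close>, and as \<open>\<phi> \<xi>\<close> increases with value \<open>1\<close> at \<open>1\<close>, the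
  gradient there is \<open>p\<close> times a factor above \<open>1\<close>; where \<open>v\<close> is less than \<open>v 0\<close> the factor is below \<open>1\<close>.
  So \<open>v\<close> lies above its tangent plane at the origin, strictly so off the hyperplane \<open>p \<bullet> y = 0\<close>
  (\<open>above_tangent_plane\<close>).

  Consequently \<open>u - v 0 - p \<bullet> y\<close> is a nonnegative superharmonic function on a punctured ball with
  lower limit zero at the puncture. Such a function vanishes (\<open>punctured_ball_rigidity\<close>), so \<open>u\<close>
  is affine near the origin. If \<open>p\<close> were nonzero, \<open>v\<close> would exceed this affine function, and thus
  \<open>u\<close>, in the direction \<open>p\<close>. Hence \<open>p = 0\<close> and \<open>v 0 \<le> v \<le> u = v 0\<close> near the origin.

  The potential theory rests on a single comparison property (\<open>dominates_subharmonic_on\<close>): on a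
  compact set \<open>w\<close> stays above any strictly subharmonic function that it dominates on the boundary. It
  follows from the distributional inequality by mollification
  (\<open>distributional_superharmonic_dominates\<close>), it is stable under subtracting affine functions, and
  quadratic polynomials together with \<open>ln (norm x)\<close> are all the comparison functions required.
\<close>

section \<open>Smooth bump functions\<close>

text \<open>
  Besides the smooth flat function \<open>exp (- 1 / s)\<close> the family contains its quotients by powers
  of \<open>s\<close>, which makes it closed under differentiation up to real linear combinations.
\<close>

definition flat :: "nat \<Rightarrow> real \<Rightarrow> real" where
  "flat j s = (if s \<le> 0 then 0 else exp (- inverse s) * inverse s ^ j)"

lemma flat_tendsto_0: "(flat j \<longlongrightarrow> 0) (at_right 0)"
proof -
  have "((\<lambda>t::real. t ^ j / exp t) \<longlongrightarrow> 0) at_top"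
    by (rule tendsto_power_div_exp_0)
  then have "((\<lambda>s::real. inverse s ^ j / exp (inverse s)) \<longlongrightarrow> 0) (at_right 0)"
    by (rule filterlim_compose[OF _ filterlim_inverse_at_top_right])
  then show ?thesis
  proof (rule Lim_transform_eventually)
    show "\<forall>\<^sub>F s in at_right (0::real). inverse s ^ j / exp (inverse s) = flat j s"
      unfolding flat_def eventually_at_right_field
      by (intro exI[of _ 1]) (auto simp: exp_minus field_simps)
  qed
qed

lemma flat_has_derivative:
  "(flat j has_real_derivative (flat (j + 2) s - real j * flat (j + 1) s)) (at s)"
proof -
  consider "s < 0" | "s = 0" | "s > 0" by linarith
  then show ?thesis
  proof cases
    case 1
    have "((\<lambda>s. 0) has_real_derivative 0) (at s)" by simp
    then have "(flat j has_real_derivative 0) (at s)"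
      by (rule has_field_derivative_transform_within_open[where S = "{..<0}"])
        (use 1 in \<open>auto simp: flat_def\<close>)
    then show ?thesis using 1 by (simp add: flat_def)
  next
    case 2
    have "((\<lambda>h. (flat j (0 + h) - flat j 0) / h) \<longlongrightarrow> 0) (at_right 0)"
    proof (rule Lim_transform_eventually[OF flat_tendsto_0[of "Suc j"]])
      show "\<forall>\<^sub>F h in at_right 0. flat (Suc j) h = (flat j (0 + h) - flat j 0) / h"
        unfolding eventually_at_right_field
        by (intro exI[of _ 1]) (auto simp: flat_def field_simps)
    qed
    moreover have "((\<lambda>h. (flat j (0 + h) - flat j 0) / h) \<longlongrightarrow> 0) (at_left 0)"
    proof (rule Lim_transform_eventually[OF tendsto_const])
      show "\<forall>\<^sub>F h in at_left 0. 0 = (flat j (0 + h) - flat j 0) / h"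
        unfolding eventually_at_left_field
        by (intro exI[of _ "-1"]) (auto simp: flat_def)
    qed
    ultimately have "((\<lambda>h. (flat j (0 + h) - flat j 0) / h) \<longlongrightarrow> 0) (at 0)"
      by (simp add: filterlim_split_at)
    then show ?thesis using 2 by (simp add: DERIV_def flat_def)
  next
    case 3
    have "((\<lambda>s. exp (- inverse s) * inverse s ^ j) has_real_derivative
        (flat (j + 2) s - real j * flat (j + 1) s)) (at s)"
      using 3
      by (auto intro!: derivative_eq_intros simp: flat_def)
        (cases j, auto simp: field_simps power2_eq_square)
    then show ?thesis
      by (rule has_field_derivative_transform_within_open[where S = "{0<..}"])
        (use 3 in \<open>auto simp: flat_def\<close>)
  qed
qed

text \<open>
  A class of functions that contains the bumps and is closed under directional derivatives.
  Membership yields smoothness of every order in one stroke, without formulas for higher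
  derivatives.
\<close>

inductive flat_generated :: "('a::euclidean_space \<Rightarrow> real) \<Rightarrow> bool" where
  const: "flat_generated (\<lambda>x. c)"
| inner: "flat_generated (\<lambda>x. x \<bullet> a)"
| add: "flat_generated f \<Longrightarrow> flat_generated g \<Longrightarrow> flat_generated (\<lambda>x. f x + g x)"
| mult: "flat_generated f \<Longrightarrow> flat_generated g \<Longrightarrow> flat_generated (\<lambda>x. f x * g x)"
| flat: "flat_generated f \<Longrightarrow> flat_generated (\<lambda>x. flat j (f x))"

lemma flat_generated_derivative:
  assumes "flat_generated f"
  shows "\<exists>f'. (\<forall>x. (f has_derivative f' x) (at x)) \<and> (\<forall>b. flat_generated (\<lambda>x. f' x b))"
  using assms
proof induction
  case (const c)
  then show ?case
    by (intro exI[of _ "\<lambda>x b. 0"]) (simp add: flat_generated.const)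
next
  case (inner a)
  then show ?case
    by (intro exI[of _ "\<lambda>x b. b \<bullet> a"] conjI allI flat_generated.const)
      (auto intro!: derivative_eq_intros)
next
  case (add f g)
  then obtain f' g' where "\<forall>x. (f has_derivative f' x) (at x)" "\<forall>b. flat_generated (\<lambda>x. f' x b)"
    "\<forall>x. (g has_derivative g' x) (at x)" "\<forall>b. flat_generated (\<lambda>x. g' x b)" by blast
  then show ?case
    by (intro exI[of _ "\<lambda>x b. f' x b + g' x b"] conjI allI flat_generated.add has_derivative_add)
      simp_all
next
  case (mult f g)
  then obtain f' g' where "\<forall>x. (f has_derivative f' x) (at x)" "\<forall>b. flat_generated (\<lambda>x. f' x b)"
    "\<forall>x. (g has_derivative g' x) (at x)" "\<forall>b. flat_generated (\<lambda>x. g' x b)" by blast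
  with mult show ?case
    by (intro exI[of _ "\<lambda>x b. f x * g' x b + f' x b * g x"] conjI allI
        flat_generated.add flat_generated.mult has_derivative_mult) simp_all
next
  case (flat f j)
  then obtain f' where f': "\<forall>x. (f has_derivative f' x) (at x)" "\<forall>b. flat_generated (\<lambda>x. f' x b)"
    by blast
  let ?d = "\<lambda>x b. (flat (j + 2) (f x) + (- real j) * flat (j + 1) (f x)) * f' x b"
  have "((\<lambda>x. flat j (f x)) has_derivative ?d x) (at x)" for x
    using has_derivative_compose[OF f'(1)[rule_format, of x]
        flat_has_derivative[of j "f x", unfolded has_field_derivative_def]]
    by (simp add: algebra_simps)
  moreover have "flat_generated (\<lambda>x. ?d x b)" for b
    using f' flat
    by (intro flat_generated.mult flat_generated.add flat_generated.flat flat_generated.const) simp_all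
  ultimately show ?case by (intro exI[of _ ?d]) blast
qed

lemma flat_generated_has_derivative:
  assumes "flat_generated f"
  shows "(f has_derivative frechet_derivative f (at x)) (at x)"
  using flat_generated_derivative[OF assms] frechet_derivative_works differentiableI by blast

lemma flat_generated_partial:
  assumes "flat_generated f"
  shows "flat_generated (partial b f)"
proof -
  obtain f' where f': "\<forall>x. (f has_derivative f' x) (at x)" "\<forall>b. flat_generated (\<lambda>x. f' x b)"
    using flat_generated_derivative[OF assms] by blast
  have "partial b f = (\<lambda>x. f' x b)"
    unfolding partial_def using frechet_derivative_at[OF f'(1)[rule_format]] by metis
  then show ?thesis using f' by simp
qed

lemma flat_generated_continuous:
  assumes "flat_generated f"
  shows "continuous_on S f"
  using flat_generated_has_derivative[OF assms]
  by (meson continuous_at_imp_continuous_on has_derivative_continuous)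

lemma flat_generated_Ck:
  assumes "flat_generated f"
  shows "Ck_on k f S"
  using assms
proof (induction k arbitrary: f)
  case 0
  then show ?case by (simp add: flat_generated_continuous)
next
  case (Suc k)
  then show ?case
    using flat_generated_has_derivative[OF Suc.prems]
    by (auto simp: differentiable_def intro!: Suc.IH flat_generated_partial)
qed

lemma flat_generated_laplacian:
  fixes f :: "'a::euclidean_space \<Rightarrow> real"
  assumes "flat_generated f"
  shows "flat_generated (laplacian f)"
proof -
  have "flat_generated (\<lambda>x. \<Sum>b\<in>B. partial b (partial b f) x)" if "finite B" for B
    using that
  proof induction
    case empty
    show ?case using flat_generated.const[of 0] by simp
  next
    case (insert b B)
    have "flat_generated (\<lambda>x. partial b (partial b f) x)"
      using flat_generated_partial[OF flat_generated_partial[OF assms]] .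
    from flat_generated.add[OF this insert.IH] insert.hyps show ?case by simp
  qed
  then show ?thesis by (simp add: laplacian_def[abs_def])
qed

text \<open>
  Restriction to lines reduces second partial derivatives to derivatives of functions of one real
  variable.
\<close>

lemma flat_generated_line_derivative:
  assumes "flat_generated f"
  shows "((\<lambda>t. f (x + t *\<^sub>R b)) has_real_derivative partial b f (x + t *\<^sub>R b)) (at t)"
proof -
  interpret linear "frechet_derivative f (at (x + t *\<^sub>R b))"
    using flat_generated_has_derivative[OF assms] has_derivative_linear by blast
  have "((\<lambda>t. x + t *\<^sub>R b) has_derivative (\<lambda>h. h *\<^sub>R b)) (at t)"
    by (auto intro!: derivative_eq_intros)
  from has_derivative_compose[OF this flat_generated_has_derivative[OF assms]]
  show ?thesis
    by (simp add: has_field_derivative_def partial_def scaleR mult.commute[of _ "frechet_derivative f (at (x + t *\<^sub>R b)) b"])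
qed

definition bump :: "real \<Rightarrow> 'a::euclidean_space \<Rightarrow> 'a \<Rightarrow> real" where
  "bump e z y = flat 0 (e\<^sup>2 - (norm (y - z))\<^sup>2)"

lemma flat_generated_bump:
  fixes z :: "'a::euclidean_space"
  shows "flat_generated (bump e z)"
proof -
  have "flat_generated (\<lambda>y. \<Sum>b\<in>B. ((y \<bullet> b + - (z \<bullet> b)) * (y \<bullet> b + - (z \<bullet> b))))" if "finite B" for B
    using that
  proof induction
    case empty
    show ?case using flat_generated.const[of 0] by simp
  next
    case (insert b B)
    have "flat_generated (\<lambda>y. y \<bullet> b + - (z \<bullet> b))"
      by (rule flat_generated.add[OF flat_generated.inner flat_generated.const])
    from flat_generated.add[OF flat_generated.mult[OF this this] insert.IH] insert.hyps
    show ?case by simp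
  qed
  then have "flat_generated (\<lambda>y. e\<^sup>2 + (-1) * (\<Sum>b\<in>Basis. ((y \<bullet> b + - (z \<bullet> b)) * (y \<bullet> b + - (z \<bullet> b)))))"
    by (intro flat_generated.add flat_generated.mult flat_generated.const) simp
  moreover have "(\<lambda>y. e\<^sup>2 + (-1) * (\<Sum>b\<in>Basis. ((y \<bullet> b + - (z \<bullet> b)) * (y \<bullet> b + - (z \<bullet> b))))) = (\<lambda>y. e\<^sup>2 - (norm (y - z))\<^sup>2)"
    by (simp only: power2_norm_eq_inner) (subst (3) euclidean_inner, simp add: inner_diff_left)
  ultimately show ?thesis unfolding bump_def[abs_def] by (metis flat_generated.flat)
qed

lemma bump_nonneg: "0 \<le> bump e z y"
  by (simp add: bump_def flat_def)

lemma bump_pos_iff: "e > 0 \<Longrightarrow> 0 < bump e z y \<longleftrightarrow> dist y z < e"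
  using power2_le_iff_abs_le[of "norm (y - z)" e] abs_le_square_iff[of e "norm (y - z)"]
  by (simp add: bump_def flat_def dist_norm not_le)

lemma bump_eq_0: "e > 0 \<Longrightarrow> e \<le> dist y z \<Longrightarrow> bump e z y = 0"
  using bump_pos_iff[of e z y] bump_nonneg[of e z y] by linarith

lemma bump_shift: "bump e (z + a) y = bump e z (y - a)"
  by (simp add: bump_def algebra_simps)

lemma test_function_bump:
  fixes z :: "'a::euclidean_space"
  assumes "e > 0" "cball z e \<subseteq> S"
  shows "test_function_on S (bump e z)"
proof -
  have "closure {x. bump e z x \<noteq> 0} \<subseteq> cball z e"
    by (rule closure_minimal) (use bump_eq_0[OF assms(1)] in \<open>force simp: dist_commute\<close>)+
  then show ?thesis
    using assms flat_generated_Ck[OF flat_generated_bump]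
    by (auto simp: test_function_on_def compact_eq_bounded_closed intro: bounded_subset)
qed

section \<open>Comparison with strictly subharmonic functions\<close>

text \<open>
  The central second difference, summed over the coordinate directions: \<open>t\<^sup>2\<close> times the
  usual discrete Laplacian with step \<open>t\<close>.
\<close>

definition second_diff :: "('a::euclidean_space \<Rightarrow> real) \<Rightarrow> 'a \<Rightarrow> real \<Rightarrow> real" where
  "second_diff g x t = (\<Sum>b\<in>Basis. g (x + t *\<^sub>R b) + g (x - t *\<^sub>R b) - 2 * g x)"

text \<open>
  The Laplacian as a limit of second differences. In this form it is visibly nonnegative at an
  interior minimum, and it passes under an integral by dominated convergence, so that the mollified
  function need not be differentiated.
\<close>

definition has_laplacian :: "('a::euclidean_space \<Rightarrow> real) \<Rightarrow> real \<Rightarrow> 'a \<Rightarrow> bool" where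
  "has_laplacian g L x \<longleftrightarrow> ((\<lambda>t. second_diff g x t / t\<^sup>2) \<longlongrightarrow> L) (at_right 0)"

text \<open>
  The comparison principle that characterizes superharmonic functions, read as a definition. It
  refers to \<open>w\<close> through inequalities alone, so subtracting an affine function amounts to
  adding it to the comparison function.
\<close>

definition dominates_subharmonic_on :: "('a::euclidean_space \<Rightarrow> real) \<Rightarrow> 'a set \<Rightarrow> bool" where
  "dominates_subharmonic_on w S \<longleftrightarrow>
     (\<forall>K g. compact K \<and> K \<subseteq> S \<and> continuous_on K g \<and>
        (\<forall>x\<in>interior K. \<exists>L>0. has_laplacian g L x) \<and> (\<forall>x\<in>K - interior K. g x \<le> w x) \<longrightarrow>
        (\<forall>x\<in>K. g x \<le> w x))"

text \<open>
  Taylor's formula with Lagrange remainder at \<open>t\<close> and at \<open>- t\<close>; the first order terms cancel.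
  Keeping the intermediate points gives both the limit of the second difference quotient and a bound
  for it that is uniform in \<open>t\<close>.
\<close>

lemma second_difference_mean_value:
  fixes f f' f'' :: "real \<Rightarrow> real"
  assumes "\<And>s. (f has_real_derivative f' s) (at s)" "\<And>s. (f' has_real_derivative f'' s) (at s)"
    and "0 < t"
  shows "\<exists>p q. \<bar>p\<bar> \<le> t \<and> \<bar>q\<bar> \<le> t \<and> f t + f (- t) - 2 * f 0 = t\<^sup>2 * ((f'' p + f'' q) / 2)"
proof -
  have taylor: "\<exists>p. 0 < p \<and> p \<le> t \<and> h t = h 0 + h' 0 * t + h'' p / 2 * t\<^sup>2"
    if "\<And>s. (h has_real_derivative h' s) (at s)" "\<And>s. (h' has_real_derivative h'' s) (at s)"
    for h h' h'' :: "real \<Rightarrow> real"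
  proof -
    let ?d = "\<lambda>m::nat. if m = 0 then h else if m = 1 then h' else h'' :: real \<Rightarrow> real"
    have "\<exists>p>0. p \<le> t \<and> h t = (\<Sum>m<2. ?d m 0 / fact m * t ^ m) + ?d 2 p / fact 2 * t ^ 2"
      by (rule Maclaurin2) (use that assms(3) in \<open>auto simp: less_Suc_eq numeral_2_eq_2\<close>)
    then show ?thesis by (auto simp: numeral_2_eq_2)
  qed
  obtain p where p: "0 < p" "p \<le> t" "f t = f 0 + f' 0 * t + f'' p / 2 * t\<^sup>2"
    using taylor[OF assms(1,2)] by blast
  have "((\<lambda>s. f (- s)) has_real_derivative - f' (- s)) (at s)" for s
    using DERIV_chain2[OF assms(1) DERIV_minus[OF DERIV_ident], of s] by simp
  moreover have "((\<lambda>s. - f' (- s)) has_real_derivative f'' (- s)) (at s)" for s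
    using DERIV_minus[OF DERIV_chain2[OF assms(2) DERIV_minus[OF DERIV_ident]], of s] by simp
  ultimately obtain q where q: "0 < q" "q \<le> t" "f (- t) = f 0 - f' 0 * t + f'' (- q) / 2 * t\<^sup>2"
    using taylor[of "\<lambda>s. f (- s)" "\<lambda>s. - f' (- s)" "\<lambda>s. f'' (- s)"] by auto
  show ?thesis
    using p q by (intro exI[of _ p] exI[of _ "- q"]) (auto simp: algebra_simps add_divide_distrib)
qed

lemma flat_generated_second_difference:
  fixes f :: "'a::euclidean_space \<Rightarrow> real"
  assumes f: "flat_generated f" and "0 < t"
  shows "\<exists>p q. \<bar>p\<bar> \<le> t \<and> \<bar>q\<bar> \<le> t \<and>
    f (x + t *\<^sub>R b) + f (x - t *\<^sub>R b) - 2 * f x =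
    t\<^sup>2 * ((partial b (partial b f) (x + p *\<^sub>R b) + partial b (partial b f) (x + q *\<^sub>R b)) / 2)"
  using second_difference_mean_value[OF flat_generated_line_derivative[OF f, of x b]
      flat_generated_line_derivative[OF flat_generated_partial[OF f], of b x b] \<open>0 < t\<close>]
  by simp

lemma flat_generated_has_laplacian:
  fixes f :: "'a::euclidean_space \<Rightarrow> real"
  assumes f: "flat_generated f"
  shows "has_laplacian f (laplacian f x) x"
proof -
  have "((\<lambda>t. (f (x + t *\<^sub>R b) + f (x - t *\<^sub>R b) - 2 * f x) / t\<^sup>2) \<longlongrightarrow> partial b (partial b f) x)
      (at_right 0)" for b
  proof (rule tendstoI)
    fix r :: real assume "0 < r"
    let ?D = "partial b (partial b f)"
    have "isCont (\<lambda>s. ?D (x + s *\<^sub>R b)) 0"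
      using DERIV_isCont[OF flat_generated_line_derivative] flat_generated_partial f by blast
    then obtain d where d: "d > 0" "\<And>s. \<bar>s\<bar> < d \<Longrightarrow> \<bar>?D (x + s *\<^sub>R b) - ?D x\<bar> < r"
      using \<open>0 < r\<close> unfolding continuous_at_eps_delta by (force simp: dist_real_def)
    have "dist ((f (x + t *\<^sub>R b) + f (x - t *\<^sub>R b) - 2 * f x) / t\<^sup>2) (?D x) < r"
      if t: "0 < t" "t < d" for t
    proof -
      obtain p q where pq: "\<bar>p\<bar> \<le> t" "\<bar>q\<bar> \<le> t"
        "f (x + t *\<^sub>R b) + f (x - t *\<^sub>R b) - 2 * f x =
         t\<^sup>2 * ((?D (x + p *\<^sub>R b) + ?D (x + q *\<^sub>R b)) / 2)"
        using flat_generated_second_difference[OF f t(1)] by blast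
      have "(f (x + t *\<^sub>R b) + f (x - t *\<^sub>R b) - 2 * f x) / t\<^sup>2 =
          (?D (x + p *\<^sub>R b) + ?D (x + q *\<^sub>R b)) / 2"
        unfolding pq(3) using t by simp
      moreover have "\<bar>?D (x + p *\<^sub>R b) - ?D x\<bar> < r" "\<bar>?D (x + q *\<^sub>R b) - ?D x\<bar> < r"
        using d(2) pq(1,2) t(2) by auto
      ultimately show ?thesis
        by (simp only: dist_real_def abs_less_iff) (simp add: field_simps)
    qed
    then show "\<forall>\<^sub>F t in at_right 0.
        dist ((f (x + t *\<^sub>R b) + f (x - t *\<^sub>R b) - 2 * f x) / t\<^sup>2) (?D x) < r"
      unfolding eventually_at_right_field using d(1) by blast
  qed
  then have "((\<lambda>t. \<Sum>b\<in>Basis. (f (x + t *\<^sub>R b) + f (x - t *\<^sub>R b) - 2 * f x) / t\<^sup>2) \<longlongrightarrow>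
      (\<Sum>b\<in>Basis. partial b (partial b f) x)) (at_right 0)"
    by (intro tendsto_sum)
  then show ?thesis
    by (simp add: has_laplacian_def second_diff_def laplacian_def sum_divide_distrib)
qed

lemma partial_eq_0_on_open:
  assumes "open T" "\<And>y. y \<in> T \<Longrightarrow> f y = 0" "y \<in> T"
  shows "partial b f y = 0"
proof -
  have "(f has_derivative (\<lambda>_. 0)) (at y)"
    by (rule has_derivative_transform_within_open[OF has_derivative_const[of 0] assms(1,3)])
      (simp add: assms(2))
  then show ?thesis unfolding partial_def by (metis frechet_derivative_at)
qed

lemma bump_second_partial_outside:
  fixes x :: "'a::euclidean_space"
  assumes "0 < e" "y \<notin> cball x e"
  shows "partial b (partial b (bump e x)) y = 0"
proof (rule partial_eq_0_on_open[where T = "- cball x e"])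
  show "partial b (bump e x) z = 0" if "z \<in> - cball x e" for z
    using that assms(1)
    by (intro partial_eq_0_on_open[where T = "- cball x e"]) (auto intro: bump_eq_0 simp: dist_commute)
qed (use assms in auto)

text \<open>
  The bound is uniform because the second partial derivatives are continuous and vanish off a compact
  ball. It provides the dominating function for the limit \<open>t \<rightarrow> 0\<close> under the integral.
\<close>

lemma bump_second_diff_bound:
  fixes x :: "'a::euclidean_space"
  assumes "0 < e"
  shows "\<exists>M. \<forall>y t. 0 < t \<longrightarrow> \<bar>second_diff (bump e x) y t\<bar> \<le> M * t\<^sup>2"
proof -
  let ?D = "\<lambda>b. partial b (partial b (bump e x))"
  have "\<exists>B. \<forall>y. \<bar>?D b y\<bar> \<le> B" for b
  proof -
    have "compact (?D b ` cball x e)"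
      by (intro compact_continuous_image flat_generated_continuous flat_generated_partial
          flat_generated_bump compact_cball)
    then obtain B where B: "\<forall>y\<in>cball x e. \<bar>?D b y\<bar> \<le> B"
      using compact_imp_bounded bounded_iff by (metis image_eqI real_norm_def)
    have "\<bar>?D b y\<bar> \<le> \<bar>B\<bar>" for y
      using B bump_second_partial_outside[OF assms, of y x b] by (cases "y \<in> cball x e") force+
    then show ?thesis by blast
  qed
  then obtain B where B: "\<And>b y. \<bar>?D b y\<bar> \<le> B b" by metis
  have "\<bar>second_diff (bump e x) y t\<bar> \<le> (\<Sum>b\<in>Basis. B b) * t\<^sup>2" if "0 < t" for y t
  proof -
    have "\<bar>bump e x (y + t *\<^sub>R b) + bump e x (y - t *\<^sub>R b) - 2 * bump e x y\<bar> \<le> t\<^sup>2 * B b" for b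
    proof -
      obtain p q where pq: "bump e x (y + t *\<^sub>R b) + bump e x (y - t *\<^sub>R b) - 2 * bump e x y =
         t\<^sup>2 * ((?D b (y + p *\<^sub>R b) + ?D b (y + q *\<^sub>R b)) / 2)"
        using flat_generated_second_difference[OF flat_generated_bump \<open>0 < t\<close>] by blast
      have "\<bar>(?D b (y + p *\<^sub>R b) + ?D b (y + q *\<^sub>R b)) / 2\<bar> \<le> B b"
        using B[of b "y + p *\<^sub>R b"] B[of b "y + q *\<^sub>R b"]
        by (simp add: abs_le_iff)
      then show ?thesis unfolding pq abs_mult by (intro mult_mono) simp_all
    qed
    then have "\<bar>second_diff (bump e x) y t\<bar> \<le> (\<Sum>b\<in>Basis. t\<^sup>2 * B b)"
      unfolding second_diff_def by (intro order_trans[OF sum_abs] sum_mono) simp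
    then show ?thesis by (simp add: sum_distrib_right mult.commute[of "t\<^sup>2"])
  qed
  then show ?thesis by blast
qed

text \<open>
  Independence of the center is translation invariance of Lebesgue measure; positivity holds because
  the bump is positive on a ball, which is not negligible. The common mass normalizes the
  mollification.
\<close>

lemma bump_mass:
  fixes x :: "'a::euclidean_space"
  assumes "0 < e"
  shows "integrable lborel (bump e x)" "integral\<^sup>L lborel (bump e x) = integral\<^sup>L lborel (bump e (0::'a))"
    "0 < integral\<^sup>L lborel (bump e x)"
proof -
  have "bump e x = (\<lambda>y. indicator (cball x e) y *\<^sub>R bump e x y)"
  proof
    fix y
    show "bump e x y = indicator (cball x e) y *\<^sub>R bump e x y"
      using bump_eq_0[OF assms, of y x] by (auto simp: indicator_def dist_commute)
  qed
  moreover have "integrable lborel (\<lambda>y. indicator (cball x e) y *\<^sub>R bump e x y)"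
    by (intro borel_integrable_compact flat_generated_continuous flat_generated_bump compact_cball)
  ultimately show int: "integrable lborel (bump e x)" by metis
  have [measurable]: "bump e (0::'a) \<in> borel_measurable borel" "bump e x \<in> borel_measurable borel"
    by (intro borel_measurable_continuous_onI flat_generated_continuous flat_generated_bump)+
  have "integral\<^sup>L lborel (bump e x) = integral\<^sup>L (distr lborel borel ((+) x)) (bump e x)"
    by (simp add: lborel_distr_plus)
  also have "\<dots> = (\<integral>y. bump e x (x + y) \<partial>lborel)"
    by (subst integral_distr) auto
  also have "\<dots> = integral\<^sup>L lborel (bump e (0::'a))"
    by (intro Bochner_Integration.integral_cong) (simp_all add: bump_def)
  finally show "integral\<^sup>L lborel (bump e x) = integral\<^sup>L lborel (bump e (0::'a))" .
  have "integral\<^sup>L lborel (bump e x) \<noteq> 0"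
  proof
    assume "integral\<^sup>L lborel (bump e x) = 0"
    then have "AE y in lborel. bump e x y = 0"
      using integral_nonneg_eq_0_iff_AE[OF int] bump_nonneg by auto
    then have "AE y in lborel. y \<notin> ball x e"
      by eventually_elim (metis bump_pos_iff[OF assms] dist_commute less_irrefl mem_ball)
    then have "ball x e \<in> null_sets lborel"
      by (subst (asm) AE_iff_null_sets[symmetric]) auto
    then have "negligible (ball x e)"
      by (simp add: negligible_iff_null_sets null_sets_completionI)
    then show False using open_not_negligible[OF open_ball] assms by force
  qed
  moreover have "0 \<le> integral\<^sup>L lborel (bump e x)" by (simp add: bump_nonneg)
  ultimately show "0 < integral\<^sup>L lborel (bump e x)" by linarith
qed

text \<open>
  The compact set \<open>K\<close> cuts off \<open>w\<close>, of which nothing is known outside the domain. At points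
  whose \<open>e\<close>-ball lies in \<open>K\<close> the cutoff has no effect. The kernel is not normalized.
\<close>

definition mollify :: "'a::euclidean_space set \<Rightarrow> real \<Rightarrow> ('a \<Rightarrow> real) \<Rightarrow> 'a \<Rightarrow> real" where
  "mollify K e w x = (\<integral>y. indicator K y *\<^sub>R (w y * bump e x y) \<partial>lborel)"

lemma integrable_on_compact_times:
  fixes w h :: "'a::euclidean_space \<Rightarrow> real"
  assumes "compact K" "continuous_on K w" "continuous_on K h"
  shows "integrable lborel (\<lambda>y. indicator K y *\<^sub>R (w y * h y))"
  using assms by (intro borel_integrable_compact continuous_on_mult)

lemma continuous_bump_shift:
  "continuous_on K (\<lambda>y. bump e x (y + a))" "continuous_on K (\<lambda>y. bump e x (y - a))"
  using flat_generated_continuous[OF flat_generated_bump, of UNIV e x]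
  by (auto intro!: continuous_on_compose2[where f = "\<lambda>y. y + a"]
      continuous_on_compose2[where f = "\<lambda>y. y - a"] continuous_intros)

lemma mollify_second_diff:
  fixes w :: "'a::euclidean_space \<Rightarrow> real"
  assumes K: "compact K" "continuous_on K w"
  shows "integrable lborel (\<lambda>y. indicator K y *\<^sub>R (w y * second_diff (bump e x) y t))"
    "second_diff (mollify K e w) x t = (\<integral>y. indicator K y *\<^sub>R (w y * second_diff (bump e x) y t) \<partial>lborel)"
proof -
  show int: "integrable lborel (\<lambda>y. indicator K y *\<^sub>R (w y * second_diff (bump e x) y t))"
    unfolding second_diff_def
    by (intro integrable_on_compact_times K continuous_intros continuous_bump_shift
        flat_generated_continuous flat_generated_bump)
  have i: "integrable lborel (\<lambda>y. indicator K y *\<^sub>R (w y * bump e x y))"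
    "integrable lborel (\<lambda>y. indicator K y *\<^sub>R (w y * bump e x (y + a)))"
    "integrable lborel (\<lambda>y. indicator K y *\<^sub>R (w y * bump e x (y - a)))" for a
    by (intro integrable_on_compact_times K continuous_intros continuous_bump_shift
        flat_generated_continuous flat_generated_bump)+
  have m: "mollify K e w (x + a) = (\<integral>y. indicator K y *\<^sub>R (w y * bump e x (y - a)) \<partial>lborel)"
    "mollify K e w (x - a) = (\<integral>y. indicator K y *\<^sub>R (w y * bump e x (y + a)) \<partial>lborel)" for a
    using bump_shift[of e x a] bump_shift[of e x "- a"] by (simp_all add: mollify_def)
  let ?I = "\<lambda>b y. indicator K y *\<^sub>R (w y * bump e x (y - t *\<^sub>R b)) +
      indicator K y *\<^sub>R (w y * bump e x (y + t *\<^sub>R b)) - 2 *\<^sub>R (indicator K y *\<^sub>R (w y * bump e x y))"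
  have "second_diff (mollify K e w) x t = (\<Sum>b\<in>Basis. \<integral>y. ?I b y \<partial>lborel)"
    unfolding second_diff_def m mollify_def[of K e w x]
    by (simp only: Bochner_Integration.integral_diff Bochner_Integration.integral_add
        Bochner_Integration.integral_scaleR_right Bochner_Integration.integrable_add
        integrable_scaleR_right i) simp
  also have "\<dots> = (\<integral>y. (\<Sum>b\<in>Basis. ?I b y) \<partial>lborel)"
    by (subst Bochner_Integration.integral_sum)
      (simp_all only: Bochner_Integration.integrable_diff Bochner_Integration.integrable_add
        integrable_scaleR_right i)
  also have "(\<lambda>y. \<Sum>b\<in>Basis. ?I b y) = (\<lambda>y. indicator K y *\<^sub>R (w y * second_diff (bump e x) y t))"
    by (auto simp: second_diff_def fun_eq_iff sum_distrib_left algebra_simps indicator_def intro!: sum.cong)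
  finally show "second_diff (mollify K e w) x t =
      (\<integral>y. indicator K y *\<^sub>R (w y * second_diff (bump e x) y t) \<partial>lborel)" .
qed

text \<open>
  Shifting the center of a bump is the same as shifting its argument, so the second difference of
  the mollification is the integral of \<open>w\<close> against a second difference of the bump. In the limit
  the latter becomes the Laplacian of the bump, a nonnegative test function, and the distributional
  inequality applies.
\<close>

lemma mollify_superharmonic:
  fixes w :: "'a::euclidean_space \<Rightarrow> real" and t :: "nat \<Rightarrow> real"
  assumes sup: "laplacian_nonpos_distr_on w S" and K: "compact K" "K \<subseteq> S" "continuous_on K w"
    and e: "0 < e" "cball x e \<subseteq> K" and t: "\<And>i. 0 < t i" "t \<longlonglongrightarrow> 0"
  shows "\<exists>L\<le>0. (\<lambda>i. second_diff (mollify K e w) x (t i) / (t i)\<^sup>2) \<longlonglongrightarrow> L"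
proof (intro exI conjI)
  let ?L = "\<integral>y. indicator K y *\<^sub>R (w y * laplacian (bump e x) y) \<partial>lborel"
  have "laplacian (bump e x) y = 0" if "y \<notin> K" for y
    unfolding laplacian_def using that e by (auto intro!: sum.neutral bump_second_partial_outside)
  then have "?L = (LINT y:S|lborel. w y * laplacian (bump e x) y)"
    unfolding set_lebesgue_integral_def using K(2)
    by (intro Bochner_Integration.integral_cong) (auto simp: indicator_def)
  also have "\<dots> \<le> 0"
    using sup test_function_bump[OF e(1), of x S] e K(2) bump_nonneg
    unfolding laplacian_nonpos_distr_on_def by blast
  finally show "?L \<le> 0" .
  obtain M where M: "\<And>y t. 0 < t \<Longrightarrow> \<bar>second_diff (bump e x) y t\<bar> \<le> M * t\<^sup>2"
    using bump_second_diff_bound[OF e(1)] by blast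
  let ?s = "\<lambda>i y. indicator K y *\<^sub>R (w y * second_diff (bump e x) y (t i)) / (t i)\<^sup>2"
  have "(\<lambda>i. integral\<^sup>L lborel (?s i)) \<longlonglongrightarrow> ?L"
  proof (rule integral_dominated_convergence[where w = "\<lambda>y. indicator K y *\<^sub>R (\<bar>w y\<bar> * M)"])
    show "(\<lambda>y. indicator K y *\<^sub>R (w y * laplacian (bump e x) y)) \<in> borel_measurable lborel"
      by (intro borel_measurable_integrable integrable_on_compact_times K flat_generated_continuous
          flat_generated_laplacian flat_generated_bump)
    show "?s i \<in> borel_measurable lborel" for i
      by (intro borel_measurable_divide borel_measurable_const
          borel_measurable_integrable[OF mollify_second_diff(1)] K)
    show "integrable lborel (\<lambda>y. indicator K y *\<^sub>R (\<bar>w y\<bar> * M))"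
      by (intro integrable_on_compact_times continuous_intros K)
    show "AE y in lborel. (\<lambda>i. ?s i y) \<longlonglongrightarrow> indicator K y *\<^sub>R (w y * laplacian (bump e x) y)"
    proof (intro always_eventually allI)
      fix y
      have "filterlim t (at_right 0) sequentially"
        using t by (auto simp: filterlim_at less_imp_neq[THEN not_sym] intro!: always_eventually)
      then have "(\<lambda>i. second_diff (bump e x) y (t i) / (t i)\<^sup>2) \<longlonglongrightarrow> laplacian (bump e x) y"
        using flat_generated_has_laplacian[OF flat_generated_bump, of e x y]
        unfolding has_laplacian_def by (rule filterlim_compose[rotated])
      then have "(\<lambda>i. indicator K y * w y * (second_diff (bump e x) y (t i) / (t i)\<^sup>2)) \<longlonglongrightarrow>
          indicator K y * w y * laplacian (bump e x) y"
        by (rule tendsto_mult_left)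
      then show "(\<lambda>i. ?s i y) \<longlonglongrightarrow> indicator K y *\<^sub>R (w y * laplacian (bump e x) y)"
        by (simp add: mult.assoc)
    qed
    show "AE y in lborel. norm (?s i y) \<le> indicator K y *\<^sub>R (\<bar>w y\<bar> * M)" for i
    proof (intro always_eventually allI)
      fix y
      have "\<bar>second_diff (bump e x) y (t i)\<bar> / (t i)\<^sup>2 \<le> M"
        using M[OF t(1)[of i], of y] t(1)[of i] by (simp add: divide_le_eq)
      then have "\<bar>w y\<bar> * (\<bar>second_diff (bump e x) y (t i)\<bar> / (t i)\<^sup>2) \<le> \<bar>w y\<bar> * M"
        by (rule mult_left_mono) simp
      then show "norm (?s i y) \<le> indicator K y *\<^sub>R (\<bar>w y\<bar> * M)"
        by (auto simp: indicator_def abs_mult)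
    qed
  qed
  moreover have "integral\<^sup>L lborel (?s i) = second_diff (mollify K e w) x (t i) / (t i)\<^sup>2" for i
    unfolding mollify_second_diff(2)[OF K(1,3)] by (rule integral_divide_zero)
  ultimately show "(\<lambda>i. second_diff (mollify K e w) x (t i) / (t i)\<^sup>2) \<longlonglongrightarrow> ?L" by (simp only:)
qed

lemma mollify_continuous:
  fixes w :: "'a::euclidean_space \<Rightarrow> real"
  assumes K: "compact K" "continuous_on K w"
  shows "continuous_on A (mollify K e w)"
  unfolding continuous_on_sequentially
proof (intro allI ballI impI)
  fix x a assume "a \<in> A" "(\<forall>n. x n \<in> A) \<and> x \<longlonglongrightarrow> a"
  then have x: "x \<longlonglongrightarrow> a" by blast
  have "(\<lambda>n. \<integral>y. indicator K y *\<^sub>R (w y * bump e (x n) y) \<partial>lborel) \<longlonglongrightarrow>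
      (\<integral>y. indicator K y *\<^sub>R (w y * bump e a y) \<partial>lborel)"
  proof (rule integral_dominated_convergence[where w = "\<lambda>y. indicator K y *\<^sub>R (\<bar>w y\<bar> * 1)"])
    show "(\<lambda>y. indicator K y *\<^sub>R (w y * bump e a y)) \<in> borel_measurable lborel" for a
      by (intro borel_measurable_integrable integrable_on_compact_times K flat_generated_continuous
          flat_generated_bump)
    then show "(\<lambda>y. indicator K y *\<^sub>R (w y * bump e (x i) y)) \<in> borel_measurable lborel" for i .
    show "integrable lborel (\<lambda>y. indicator K y *\<^sub>R (\<bar>w y\<bar> * 1))"
      by (intro integrable_on_compact_times continuous_intros K)
    show "AE y in lborel. (\<lambda>i. indicator K y *\<^sub>R (w y * bump e (x i) y)) \<longlonglongrightarrow> indicator K y *\<^sub>R (w y * bump e a y)"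
    proof (intro always_eventually allI tendsto_intros)
      fix y
      have "(\<lambda>i. flat 0 (e\<^sup>2 - (norm (y - x i))\<^sup>2)) \<longlonglongrightarrow> flat 0 (e\<^sup>2 - (norm (y - a))\<^sup>2)"
        using x by (intro isCont_tendsto_compose[OF DERIV_isCont[OF flat_has_derivative]] tendsto_intros)
      then show "(\<lambda>i. bump e (x i) y) \<longlonglongrightarrow> bump e a y" by (simp add: bump_def)
    qed
    show "AE y in lborel. norm (indicator K y *\<^sub>R (w y * bump e (x i) y)) \<le> indicator K y *\<^sub>R (\<bar>w y\<bar> * 1)" for i
      by (intro always_eventually allI)
        (auto simp: indicator_def abs_mult bump_def flat_def intro!: mult_left_le)
  qed
  then show "((mollify K e w) \<circ> x) \<longlonglongrightarrow> mollify K e w a" by (simp add: mollify_def o_def)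
qed

lemma mollify_approximates:
  fixes w :: "'a::euclidean_space \<Rightarrow> real"
  assumes K: "compact K" "continuous_on K w" and e: "0 < e" "cball x e \<subseteq> K"
    and osc: "\<And>y. dist y x < e \<Longrightarrow> \<bar>w y - w x\<bar> \<le> r"
  shows "\<bar>mollify K e w x / integral\<^sup>L lborel (bump e (0::'a)) - w x\<bar> \<le> r"
proof -
  define c where "c = integral\<^sup>L lborel (bump e (0::'a))"
  have c: "c = integral\<^sup>L lborel (bump e x)" "0 < c"
    using bump_mass(2)[OF e(1), of x] bump_mass(3)[OF e(1), of 0] by (simp_all add: c_def)
  have int: "integrable lborel (\<lambda>y. indicator K y *\<^sub>R (w y * bump e x y))"
    by (intro integrable_on_compact_times K flat_generated_continuous flat_generated_bump)
  have "mollify K e w x - w x * c = (\<integral>y. indicator K y *\<^sub>R (w y * bump e x y) - w x * bump e x y \<partial>lborel)"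
    unfolding mollify_def c(1)
    by (subst Bochner_Integration.integral_diff[OF int])
      (simp_all only: integrable_mult_right[OF bump_mass(1)[OF e(1)]] integral_mult_right_zero)
  also have "\<bar>\<dots>\<bar> \<le> (\<integral>y. r * bump e x y \<partial>lborel)"
  proof (rule order_trans[OF integral_abs_bound], rule integral_mono)
    show "integrable lborel (\<lambda>y. \<bar>indicator K y *\<^sub>R (w y * bump e x y) - w x * bump e x y\<bar>)"
      by (intro integrable_abs Bochner_Integration.integrable_diff int integrable_mult_right bump_mass e)
    show "integrable lborel (\<lambda>y. r * bump e x y)"
      by (intro integrable_mult_right bump_mass e)
    fix y
    show "\<bar>indicator K y *\<^sub>R (w y * bump e x y) - w x * bump e x y\<bar> \<le> r * bump e x y"
    proof (cases "dist y x < e")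
      case True
      then have "y \<in> K" using e by (force simp: dist_commute)
      then have "indicator K y *\<^sub>R (w y * bump e x y) - w x * bump e x y = (w y - w x) * bump e x y"
        by (simp add: algebra_simps)
      then show ?thesis
        using mult_right_mono[OF osc[OF True] bump_nonneg[of e x y]] bump_nonneg[of e x y]
        by (simp add: abs_mult)
    next
      case False
      then show ?thesis using bump_eq_0[OF e(1), of y x] by simp
    qed
  qed
  also have "\<dots> = r * c" using c(1) by simp
  finally have "\<bar>mollify K e w x - w x * c\<bar> \<le> r * c" .
  moreover have "mollify K e w x / c - w x = (mollify K e w x - w x * c) / c"
    using c(2) by (simp add: field_simps)
  ultimately have "\<bar>mollify K e w x / c - w x\<bar> \<le> r"
    using c(2) by (simp add: divide_le_eq)
  then show ?thesis by (simp add: c_def)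
qed

text \<open>
  If \<open>g\<close> exceeded \<open>w\<close> somewhere, then for a fine mollification \<open>J\<close> of \<open>w\<close> the difference \<open>J - g\<close>
  would be smaller there than on the boundary, and so would have an interior minimum. There its
  second differences are nonnegative, whereas the Laplacian of \<open>J\<close> is at most zero and that of \<open>g\<close>
  is positive.
\<close>

theorem distributional_superharmonic_dominates:
  fixes w :: "'a::euclidean_space \<Rightarrow> real"
  assumes S: "open S" "continuous_on S w" and sup: "laplacian_nonpos_distr_on w S"
  shows "dominates_subharmonic_on w S"
  unfolding dominates_subharmonic_on_def
proof (intro allI impI ballI, elim conjE, rule ccontr)
  fix K g y0
  assume K: "compact K" "K \<subseteq> S" and g: "continuous_on K g"
    and lap: "\<forall>x\<in>interior K. \<exists>L>0. has_laplacian g L x"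
    and bd: "\<forall>x\<in>K - interior K. g x \<le> w x"
    and y0: "y0 \<in> K" "\<not> g y0 \<le> w y0"
  \<comment> \<open>A quarter of the gap: mollifying costs at most \<open>r\<close> at \<open>y0\<close> and at most \<open>r\<close> on the boundary.\<close>
  define r where "r = (g y0 - w y0) / 4"
  have r: "0 < r" using y0 by (simp add: r_def)
  obtain d where d: "d > 0" "{x. infdist x K \<le> d} \<subseteq> S"
    using compact_in_open_separated[of K S] K S(1) y0 by auto
  define K' where "K' = {x. infdist x K \<le> d}"
  have K': "compact K'" "K' \<subseteq> S" "continuous_on K' w"
    using d S(2) compact_infdist_le[of K d] K(1) y0 continuous_on_subset by (auto simp: K'_def)
  have "uniformly_continuous_on K' w"
    using K' compact_uniformly_continuous by blast
  then obtain e0 where e0: "e0 > 0" "\<And>x y. x \<in> K' \<Longrightarrow> y \<in> K' \<Longrightarrow> dist y x < e0 \<Longrightarrow> dist (w y) (w x) < r"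
    unfolding uniformly_continuous_on_def using r by metis
  define e where "e = min d e0"
  have e: "e > 0" "e \<le> d" "e \<le> e0" using d e0 by (auto simp: e_def)
  have ball: "cball x e \<subseteq> K'" if "x \<in> K" for x
    unfolding K'_def
    using order_trans[OF infdist_le[OF that] order_trans[OF _ e(2)]] by (auto simp: dist_commute)
  define c where "c = integral\<^sup>L lborel (bump e (0::'a))"
  have c: "0 < c" using bump_mass[OF e(1)] by (simp add: c_def)
  define J where "J = (\<lambda>x. mollify K' e w x / c)"
  have J: "\<bar>J x - w x\<bar> \<le> r" if "x \<in> K" for x
    unfolding J_def c_def
  proof (rule mollify_approximates[OF K'(1,3) e(1) ball[OF that]])
    fix y assume "dist y x < e"
    moreover have "y \<in> K'" using calculation ball[OF that] by (force simp: dist_commute)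
    moreover have "x \<in> K'" using ball[OF that] e(1) by force
    ultimately show "\<bar>w y - w x\<bar> \<le> r" using e0(2)[of x y] e(3) by (simp add: dist_real_def)
  qed
  have "continuous_on K (\<lambda>x. J x - g x)"
    unfolding J_def using mollify_continuous[OF K'(1,3)] g c by (auto intro!: continuous_intros)
  then obtain x where x: "x \<in> K" "\<And>y. y \<in> K \<Longrightarrow> J x - g x \<le> J y - g y"
    using continuous_attains_inf[OF K(1)] y0 by blast
  have "J x - g x < - r"
  proof -
    have "J y0 - w y0 \<le> r" "g y0 - w y0 = 4 * r"
      using J[OF y0(1)] by (simp_all only: abs_le_iff) (simp_all add: r_def)
    then show ?thesis using x(2)[OF y0(1)] r by linarith
  qed
  moreover have "w x - r \<le> J x" using J[OF x(1)] by (simp only: abs_le_iff) simp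
  ultimately have "\<not> g x \<le> w x" by linarith
  then have "x \<in> interior K" using bd x(1) by blast
  then obtain L where L: "L > 0" "has_laplacian g L x" using lap by blast
  obtain s where s: "s > 0" "cball x s \<subseteq> K"
    using \<open>x \<in> interior K\<close> mem_interior_cball by blast
  define t where "t = (\<lambda>i. s / real (Suc i))"
  have "t \<longlonglongrightarrow> 0"
    unfolding t_def by (intro LIMSEQ_Suc lim_const_over_n)
  moreover have t: "0 < t i" "t i \<le> s" for i using s by (auto simp: t_def field_simps)
  ultimately obtain L' where L': "L' \<le> 0" "(\<lambda>i. second_diff (mollify K' e w) x (t i) / (t i)\<^sup>2) \<longlonglongrightarrow> L'"
    using mollify_superharmonic[OF sup K' e(1) ball[OF x(1)], of t] by blast
  have "filterlim t (at_right 0) sequentially"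
    using t \<open>t \<longlonglongrightarrow> 0\<close> by (auto simp: filterlim_at less_imp_neq[THEN not_sym] intro!: always_eventually)
  then have "(\<lambda>i. second_diff g x (t i) / (t i)\<^sup>2) \<longlonglongrightarrow> L"
    using L(2) unfolding has_laplacian_def by (rule filterlim_compose[rotated])
  from tendsto_diff[OF tendsto_divide[OF L'(2) tendsto_const[of c]] this]
  have lim: "(\<lambda>i. second_diff (mollify K' e w) x (t i) / (t i)\<^sup>2 / c - second_diff g x (t i) / (t i)\<^sup>2)
      \<longlonglongrightarrow> L' / c - L" using c by simp
  have "0 \<le> second_diff (mollify K' e w) x (t i) / (t i)\<^sup>2 / c - second_diff g x (t i) / (t i)\<^sup>2" for i
  proof -
    have "second_diff (mollify K' e w) x (t i) / c - second_diff g x (t i) =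
      (\<Sum>b\<in>Basis. (J (x + t i *\<^sub>R b) - g (x + t i *\<^sub>R b)) + (J (x - t i *\<^sub>R b) - g (x - t i *\<^sub>R b)) - 2 * (J x - g x))"
      unfolding second_diff_def J_def sum_divide_distrib sum_subtractf[symmetric]
      by (intro sum.cong) (auto simp: add_divide_distrib diff_divide_distrib)
    also have "\<dots> \<ge> 0"
    proof (rule sum_nonneg)
      fix b :: 'a assume "b \<in> Basis"
      then have "x + t i *\<^sub>R b \<in> K" "x - t i *\<^sub>R b \<in> K"
        using s(2) t[of i] by (auto simp: dist_norm subset_eq)
      then have "J x - g x \<le> J (x + t i *\<^sub>R b) - g (x + t i *\<^sub>R b)"
        "J x - g x \<le> J (x - t i *\<^sub>R b) - g (x - t i *\<^sub>R b)"
        by (auto intro: x(2))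
      then show "0 \<le> (J (x + t i *\<^sub>R b) - g (x + t i *\<^sub>R b)) + (J (x - t i *\<^sub>R b) - g (x - t i *\<^sub>R b)) - 2 * (J x - g x)"
        using add_mono by fastforce
    qed
    finally have "0 \<le> (second_diff (mollify K' e w) x (t i) / c - second_diff g x (t i)) / (t i)\<^sup>2" by simp
    then show ?thesis by (simp add: diff_divide_distrib mult.commute)
  qed
  then have "0 \<le> L' / c - L" by (intro LIMSEQ_le_const[OF lim]) blast
  moreover have "L' / c \<le> 0" using L'(1) c by (simp add: divide_nonpos_pos)
  ultimately show False using L(1) by linarith
qed

section \<open>Superharmonic functions on a punctured ball\<close>

lemma has_laplacian_add:
  assumes "has_laplacian f L x" "has_laplacian g M x"
  shows "has_laplacian (\<lambda>y. f y + g y) (L + M) x"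
proof -
  have "second_diff (\<lambda>y. f y + g y) x t = second_diff f x t + second_diff g x t" for t
    by (simp add: second_diff_def sum.distrib[symmetric] algebra_simps)
  then show ?thesis
    using tendsto_add[OF assms[unfolded has_laplacian_def]]
    by (simp add: has_laplacian_def add_divide_distrib)
qed

lemma has_laplacian_cmult:
  assumes "has_laplacian f L x"
  shows "has_laplacian (\<lambda>y. c * f y) (c * L) x"
proof -
  have "second_diff (\<lambda>y. c * f y) x t = c * second_diff f x t" for t
    by (simp add: second_diff_def sum_distrib_left algebra_simps)
  then show ?thesis
    using tendsto_mult_left[OF assms[unfolded has_laplacian_def], of c]
    by (simp add: has_laplacian_def)
qed

lemma has_laplacian_quadratic:
  fixes x z p e :: "'a::euclidean_space"
  shows "has_laplacian (\<lambda>y. a + p \<bullet> y + c * (e \<bullet> (y - z))\<^sup>2 + d * (norm (y - z))\<^sup>2)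
    (2 * c * (norm e)\<^sup>2 + 2 * d * real DIM('a)) x"
proof -
  let ?q = "\<lambda>y. a + p \<bullet> y + c * (e \<bullet> (y - z))\<^sup>2 + d * (norm (y - z))\<^sup>2"
  have "?q (x + t *\<^sub>R b) + ?q (x - t *\<^sub>R b) - 2 * ?q x = t\<^sup>2 * (2 * c * (e \<bullet> b)\<^sup>2 + 2 * d)"
    if "b \<in> Basis" for b t
    using that unfolding power2_norm_eq_inner
    by (simp add: inner_simps inner_commute algebra_simps power2_eq_square)
  then have "second_diff ?q x t = t\<^sup>2 * (\<Sum>b\<in>Basis. 2 * c * (e \<bullet> b)\<^sup>2 + 2 * d)" for t
    by (simp add: second_diff_def sum_distrib_left)
  moreover have "(\<Sum>b\<in>Basis. 2 * c * (e \<bullet> b)\<^sup>2 + 2 * d) = 2 * c * (norm e)\<^sup>2 + 2 * d * real DIM('a)"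
    by (simp add: sum.distrib sum_distrib_left[symmetric] norm_eq_sqrt_inner euclidean_inner[of e e]
        power2_eq_square sum_nonneg)
  ultimately have "\<forall>\<^sub>F t in at_right 0. 2 * c * (norm e)\<^sup>2 + 2 * d * real DIM('a) = second_diff ?q x t / t\<^sup>2"
    unfolding eventually_at_right_field by (intro exI[of _ 1]) auto
  then show ?thesis unfolding has_laplacian_def
    by (rule Lim_transform_eventually[OF tendsto_const])
qed

lemma has_laplacian_affine:
  "has_laplacian (\<lambda>y. a + p \<bullet> y) 0 x"
  using has_laplacian_quadratic[of a p 0 0 0 0] by simp

text \<open>
  The product of \<open>(norm (x + t b))\<^sup>2\<close> and \<open>(norm (x - t b))\<^sup>2\<close> is a polynomial in \<open>t\<^sup>2\<close>, so the second
  difference is a first difference of a smooth function of \<open>s = t\<^sup>2\<close> at \<open>s = 0\<close>. The logarithm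
  is subharmonic in every dimension from two on, so that one barrier at the puncture serves for all
  of them.
\<close>

lemma has_laplacian_ln_norm:
  fixes x :: "'a::euclidean_space"
  assumes "x \<noteq> 0"
  shows "has_laplacian (\<lambda>y. ln (norm y)) ((real DIM('a) - 2) / (norm x)\<^sup>2) x"
proof -
  define A where "A = (norm x)\<^sup>2"
  have A: "0 < A" using assms by (simp add: A_def)
  let ?l = "\<lambda>y::'a. ln (norm y)"
  have "((\<lambda>t. (?l (x + t *\<^sub>R b) + ?l (x - t *\<^sub>R b) - 2 * ?l x) / t\<^sup>2) \<longlongrightarrow> (A - 2 * (x \<bullet> b)\<^sup>2) / A\<^sup>2)
      (at_right 0)" if b: "b \<in> Basis" for b
  proof -
    define a where "a = x \<bullet> b"
    define q where "q = (\<lambda>s. ln ((A + s)\<^sup>2 - 4 * s * a\<^sup>2) / 2)"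
    have n: "(norm (x + t *\<^sub>R b))\<^sup>2 * (norm (x - t *\<^sub>R b))\<^sup>2 = (A + t\<^sup>2)\<^sup>2 - 4 * t\<^sup>2 * a\<^sup>2" for t
      using b unfolding A_def a_def power2_norm_eq_inner
      by (simp add: inner_simps inner_commute algebra_simps power2_eq_square)
    have "(q has_real_derivative (A - 2 * a\<^sup>2) / A\<^sup>2) (at 0)"
      unfolding q_def using A
      by (auto intro!: derivative_eq_intros simp: divide_simps power2_eq_square)
    then have "((\<lambda>s. (q s - q 0) / s) \<longlongrightarrow> (A - 2 * a\<^sup>2) / A\<^sup>2) (at 0)"
      by (simp add: DERIV_def)
    moreover have "filterlim (\<lambda>t::real. t\<^sup>2) (at 0) (at_right 0)"
      unfolding filterlim_at
      by (auto simp: eventually_at_right_field intro!: tendsto_eq_intros exI[of _ 1])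
    ultimately have "((\<lambda>t. (q (t\<^sup>2) - q 0) / t\<^sup>2) \<longlongrightarrow> (A - 2 * a\<^sup>2) / A\<^sup>2) (at_right 0)"
      by (rule filterlim_compose)
    moreover have "\<forall>\<^sub>F t in at_right 0.
        (q (t\<^sup>2) - q 0) / t\<^sup>2 = (?l (x + t *\<^sub>R b) + ?l (x - t *\<^sub>R b) - 2 * ?l x) / t\<^sup>2"
      unfolding eventually_at_right_field
    proof (intro exI[of _ "norm x"] conjI allI impI)
      fix t assume t: "0 < t" "t < norm x"
      have "x + t *\<^sub>R b \<noteq> 0" "x - t *\<^sub>R b \<noteq> 0"
        using t b by (auto simp: add_eq_0_iff2)
      then have "ln ((norm (x + t *\<^sub>R b))\<^sup>2 * (norm (x - t *\<^sub>R b))\<^sup>2) = 2 * ?l (x + t *\<^sub>R b) + 2 * ?l (x - t *\<^sub>R b)"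
        by (simp add: ln_mult ln_realpow)
      moreover have "ln (A\<^sup>2) = 4 * ?l x" using assms by (simp add: A_def ln_realpow)
      ultimately show "(q (t\<^sup>2) - q 0) / t\<^sup>2 = (?l (x + t *\<^sub>R b) + ?l (x - t *\<^sub>R b) - 2 * ?l x) / t\<^sup>2"
        by (simp add: q_def n)
    qed (use assms in simp)
    ultimately show ?thesis unfolding a_def by (rule Lim_transform_eventually)
  qed
  then have "((\<lambda>t. \<Sum>b\<in>Basis. (?l (x + t *\<^sub>R b) + ?l (x - t *\<^sub>R b) - 2 * ?l x) / t\<^sup>2) \<longlongrightarrow>
      (\<Sum>b\<in>Basis. (A - 2 * (x \<bullet> b)\<^sup>2) / A\<^sup>2)) (at_right 0)"
    by (rule tendsto_sum)
  moreover have "(\<Sum>b\<in>Basis. (A - 2 * (x \<bullet> b)\<^sup>2) / A\<^sup>2) = (real DIM('a) - 2) / A"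
  proof -
    have "(\<Sum>b\<in>Basis. (x \<bullet> b)\<^sup>2) = A"
      unfolding A_def power2_norm_eq_inner by (subst (2) euclidean_inner) (simp add: power2_eq_square)
    then have "(\<Sum>b\<in>Basis. A - 2 * (x \<bullet> b)\<^sup>2) = real DIM('a) * A - 2 * A"
      by (simp add: sum_subtractf sum_distrib_left[symmetric])
    then show ?thesis
      using A by (simp add: sum_divide_distrib[symmetric] power2_eq_square field_simps)
  qed
  ultimately show ?thesis
    by (simp add: has_laplacian_def second_diff_def sum_divide_distrib A_def)
qed

lemma dominates_subharmonic_subset:
  assumes "dominates_subharmonic_on w S" "T \<subseteq> S"
  shows "dominates_subharmonic_on w T"
  using assms unfolding dominates_subharmonic_on_def by (meson order_trans)

lemma dominates_subharmonic_diff_affine: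
  assumes "dominates_subharmonic_on w S"
  shows "dominates_subharmonic_on (\<lambda>x. w x - (a + p \<bullet> x)) S"
  unfolding dominates_subharmonic_on_def
proof (intro allI impI, elim conjE)
  fix K g
  assume K: "compact K" "K \<subseteq> S" "continuous_on K g" "\<forall>x\<in>interior K. \<exists>L>0. has_laplacian g L x"
    "\<forall>x\<in>K - interior K. g x \<le> w x - (a + p \<bullet> x)"
  let ?g = "\<lambda>x. g x + (a + p \<bullet> x)"
  have "\<exists>L>0. has_laplacian ?g L x" if "x \<in> interior K" for x
    using K(4) that has_laplacian_add[OF _ has_laplacian_affine[of a p x]] by fastforce
  moreover have "continuous_on K ?g" using K(3) by (intro continuous_intros)
  moreover have "\<forall>x\<in>K - interior K. ?g x \<le> w x" using K(5) by (simp add: le_diff_eq)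
  ultimately have "\<forall>x\<in>K. ?g x \<le> w x"
    using assms K(1,2) unfolding dominates_subharmonic_on_def by blast
  then show "\<forall>x\<in>K. g x \<le> w x - (a + p \<bullet> x)" by (simp add: le_diff_eq)
qed

text \<open>
  A point is removable for functions bounded below: adding \<open>c * ln (norm x / r)\<close> to \<open>h\<close> with a small
  \<open>c > 0\<close> keeps it subharmonic, does not change it on the outer sphere, and pushes it below the lower
  bound \<open>M\<close> on tiny spheres around the origin. The ordinary comparison principle then applies on an
  annulus.
\<close>

lemma punctured_ball_comparison:
  fixes w h :: "'a::euclidean_space \<Rightarrow> real"
  assumes dim: "2 \<le> DIM('a)"
    and w: "dominates_subharmonic_on w (ball 0 R - {0})" and r: "0 < r" "r < R"
    and h: "continuous_on UNIV h" "\<And>x. \<exists>L>0. has_laplacian h L x"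
    and sphere: "\<And>x. norm x = r \<Longrightarrow> h x \<le> w x"
    and below: "\<And>x. x \<noteq> 0 \<Longrightarrow> norm x < r \<Longrightarrow> M \<le> w x"
    and y: "y \<noteq> 0" "norm y \<le> r"
  shows "h y \<le> w y"
proof (rule ccontr)
  assume "\<not> h y \<le> w y"
  then have less: "w y < h y" "norm y < r" using sphere[of y] y by force+
  have ln_pos: "0 < ln r - ln (norm y)" using less y r by simp
  \<comment> \<open>This choice lowers the comparison function at \<open>y\<close> by exactly half of the gap.\<close>
  define c where "c = (h y - w y) / 2 / (ln r - ln (norm y))"
  have c: "0 < c" using less ln_pos by (simp add: c_def)
  define g where "g = (\<lambda>x. h x + (- c * ln r + c * ln (norm x)))"
  have gy: "w y < g y"
  proof -
    have "g y = h y - c * (ln r - ln (norm y))" by (simp add: g_def algebra_simps)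
    also have "c * (ln r - ln (norm y)) = (h y - w y) / 2"
      unfolding c_def by (rule nonzero_eq_divide_eq[THEN iffD1]) (use ln_pos in auto)
    finally show ?thesis using less by (simp add: field_simps)
  qed
  have "compact (h ` cball 0 r)"
    using h(1) by (intro compact_continuous_image) (auto intro: continuous_on_subset)
  then obtain H where H: "\<And>x. norm x \<le> r \<Longrightarrow> h x \<le> H"
    using compact_imp_bounded bounded_imp_bdd_above
    unfolding bdd_above_def by (metis image_eqI mem_cball_0)
  \<comment> \<open>The second entry solves \<open>H + c * ln (s / r) = M\<close>.\<close>
  define s where "s = min (norm y / 2) (r * exp ((M - H) / c))"
  have s: "0 < s" "s < norm y" "s \<le> r * exp ((M - H) / c)"
  proof -
    have "s \<le> norm y / 2" "s \<le> r * exp ((M - H) / c)" by (simp_all add: s_def)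
    moreover have "norm y / 2 < norm y" using y(1) by simp
    ultimately show "s < norm y" "s \<le> r * exp ((M - H) / c)" by (blast intro: le_less_trans)+
    show "0 < s" using y r by (simp add: s_def)
  qed
  have "ln s \<le> ln (r * exp ((M - H) / c))" using s r by simp
  also have "\<dots> = ln r + (M - H) / c" using r by (simp add: ln_mult)
  finally have "c * ln s \<le> c * (ln r + (M - H) / c)"
    using c by (intro mult_left_mono) auto
  then have small: "c * ln s \<le> c * ln r + (M - H)" using c by (simp add: distrib_left)
  define K where "K = cball 0 r - ball (0::'a) s"
  have K: "compact K" "K \<subseteq> ball 0 R - {0}"
    using r s by (auto simp: K_def intro: compact_diff)
  have "ball 0 r - cball 0 s \<subseteq> interior K"
    by (rule interior_maximal) (auto simp: K_def intro: open_Diff)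
  then have bd: "norm x = r \<or> norm x = s" if "x \<in> K - interior K" for x
    using that by (force simp: K_def)
  have nz: "x \<noteq> 0" if "x \<in> K" for x using that s by (auto simp: K_def)
  have "continuous_on K g"
    unfolding g_def using h(1) nz by (auto intro!: continuous_intros intro: continuous_on_subset)
  moreover have "\<exists>L>0. has_laplacian g L x" if x: "x \<in> interior K" for x
  proof -
    obtain L where L: "L > 0" "has_laplacian h L x" using h(2) by blast
    have "x \<noteq> 0" using nz interior_subset x by blast
    have "has_laplacian g (L + (0 + c * ((real DIM('a) - 2) / (norm x)\<^sup>2))) x"
      unfolding g_def
      using has_laplacian_affine[of "- c * ln r" 0 x]
      by (intro has_laplacian_add has_laplacian_cmult L has_laplacian_ln_norm \<open>x \<noteq> 0\<close>) simp
    moreover have "0 \<le> c * ((real DIM('a) - 2) / (norm x)\<^sup>2)" using dim c by simp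
    ultimately show ?thesis using L(1) by (metis add_0 add_pos_nonneg)
  qed
  moreover have "g x \<le> w x" if x: "x \<in> K - interior K" for x
    using bd[OF x]
  proof
    assume "norm x = r"
    then show ?thesis using sphere by (simp add: g_def)
  next
    assume nx: "norm x = s"
    then have "g x \<le> M" using small H[of x] s less by (simp add: g_def)
    also have "M \<le> w x" using nx s less by (intro below) auto
    finally show ?thesis .
  qed
  ultimately have "\<forall>x\<in>K. g x \<le> w x"
    using w K unfolding dominates_subharmonic_on_def by blast
  moreover have "y \<in> K" using y s by (simp add: K_def)
  ultimately show False using gy by force
qed

text \<open>
  Subtracting the mean of the two affine functions leaves a function that is at least
  \<open>\<bar>q \<bullet> y\<bar> - e * norm y\<close>, where \<open>q\<close> is half the difference of the gradients. On the sphere of radius \<open>r\<close>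
  the absolute value dominates \<open>(q \<bullet> y)\<^sup>2 / (norm q * r)\<close>, and subtracting a multiple of
  \<open>(norm y)\<^sup>2 - r\<^sup>2\<close> from this quadratic form leaves it unchanged on the sphere. With a suitable multiple
  the result is still strictly subharmonic but positive at the center, by an amount that beats the
  error \<open>e * r\<close>. Comparison then keeps the function away from zero near the puncture, contrary to
  \<open>limit\<close>.
\<close>

lemma supporting_gradient_unique:
  fixes w :: "'a::euclidean_space \<Rightarrow> real"
  assumes dim: "2 \<le> DIM('a)" and R: "0 < R"
    and w: "dominates_subharmonic_on w (ball 0 R - {0})"
    and lower: "\<And>e. e > 0 \<Longrightarrow> \<exists>r>0. \<forall>y. y \<noteq> 0 \<and> norm y < r \<longrightarrow> a + p \<bullet> y - e * norm y \<le> w y"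
      "\<And>e. e > 0 \<Longrightarrow> \<exists>r>0. \<forall>y. y \<noteq> 0 \<and> norm y < r \<longrightarrow> a + p' \<bullet> y - e * norm y \<le> w y"
    and limit: "\<And>e r. e > 0 \<Longrightarrow> r > 0 \<Longrightarrow> \<exists>y. y \<noteq> 0 \<and> norm y < r \<and> w y < a + e"
  shows "p = p'"
proof (rule ccontr)
  assume "p \<noteq> p'"
  define q where "q = (p - p') /\<^sub>R 2"
  define m where "m = (p + p') /\<^sub>R 2"
  have q: "0 < norm q" using \<open>p \<noteq> p'\<close> by (simp add: q_def)
  have pq: "p = m + q" "p' = m - q"
    by (simp_all add: q_def m_def euclidean_eq_iff[where 'a='a] inner_simps field_simps)
  define n where "n = real DIM('a)"
  have n: "0 < n" by (simp add: n_def)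
  define e where "e = norm q / (4 * n)"
  have e: "0 < e" using q n by (simp add: e_def)
  define w' where "w' = (\<lambda>x. w x - (a + m \<bullet> x))"
  have w': "dominates_subharmonic_on w' (ball 0 R - {0})"
    unfolding w'_def by (rule dominates_subharmonic_diff_affine[OF w])
  obtain r1 r2 where r12: "r1 > 0" "\<And>y. y \<noteq> 0 \<Longrightarrow> norm y < r1 \<Longrightarrow> a + p \<bullet> y - e * norm y \<le> w y"
    "r2 > 0" "\<And>y. y \<noteq> 0 \<Longrightarrow> norm y < r2 \<Longrightarrow> a + p' \<bullet> y - e * norm y \<le> w y"
    using lower[OF e] by metis
  define r where "r = min R (min r1 r2) / 2"
  have r: "0 < r" "r < R" "r < r1" "r < r2" using R r12 by (auto simp: r_def min_def)
  have w'_ge: "\<bar>q \<bullet> y\<bar> - e * norm y \<le> w' y" if "y \<noteq> 0" "norm y \<le> r" for y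
    using r12(2)[of y] r12(4)[of y] that r by (auto simp: w'_def pq inner_simps abs_if)
  \<comment> \<open>Half of the value \<open>norm q / (n * r)\<close> for which the quadratic form would be harmonic.\<close>
  define d where "d = norm q / (2 * n * r)"
  define h where "h = (\<lambda>y. (d * r\<^sup>2 - e * r) + 0 \<bullet> y + (1 / (norm q * r)) * (q \<bullet> (y - 0))\<^sup>2 + (- d) * (norm (y - 0))\<^sup>2)"
  have h0: "h 0 = e * r"
    using n r by (simp add: h_def d_def e_def power2_eq_square field_simps)
  have cont: "continuous_on UNIV h" unfolding h_def by (intro continuous_intros)
  have "h y \<le> w' y" if y: "y \<noteq> 0" "norm y \<le> r" for y
  proof (rule punctured_ball_comparison[OF dim w' r(1,2) cont _ _ _ y, where M = "- e * r"])
    fix x :: 'a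
    have "2 * (1 / (norm q * r)) * (norm q)\<^sup>2 = 2 * (norm q / r)"
      using q by (simp add: power2_eq_square)
    moreover have "2 * (- d) * n = - (norm q / r)" using n by (simp add: d_def)
    ultimately have "2 * (1 / (norm q * r)) * (norm q)\<^sup>2 + 2 * (- d) * n = norm q / r" by linarith
    moreover have "has_laplacian h (2 * (1 / (norm q * r)) * (norm q)\<^sup>2 + 2 * (- d) * n) x"
      unfolding h_def n_def by (rule has_laplacian_quadratic)
    ultimately have "has_laplacian h (norm q / r) x" by simp
    then show "\<exists>L>0. has_laplacian h L x" using q r by (intro exI[of _ "norm q / r"]) simp
  next
    fix x :: 'a assume x: "norm x = r"
    have "\<bar>q \<bullet> x\<bar> \<le> norm q * r" using Cauchy_Schwarz_ineq2[of q x] x by simp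
    then have "\<bar>q \<bullet> x\<bar> * \<bar>q \<bullet> x\<bar> \<le> \<bar>q \<bullet> x\<bar> * (norm q * r)" by (intro mult_left_mono) auto
    then have "(q \<bullet> x)\<^sup>2 / (norm q * r) \<le> \<bar>q \<bullet> x\<bar>"
      using q r by (simp add: divide_le_eq power2_eq_square)
    then have "h x \<le> \<bar>q \<bullet> x\<bar> - e * norm x" by (simp add: h_def x)
    also have "\<dots> \<le> w' x" using x r by (intro w'_ge) auto
    finally show "h x \<le> w' x" .
  next
    fix x :: 'a assume x: "x \<noteq> 0" "norm x < r"
    have "e * norm x \<le> e * r" using x e by (intro mult_left_mono) auto
    then show "- e * r \<le> w' x" using w'_ge[of x] x by simp
  qed
  moreover have "isCont (\<lambda>y. h y + m \<bullet> y) 0"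
    using cont by (intro continuous_intros) (simp add: continuous_on_eq_continuous_at)
  ultimately obtain s where s: "s > 0" "\<And>y. norm y < s \<Longrightarrow> \<bar>h y + m \<bullet> y - h 0\<bar> < e * r / 2"
    unfolding continuous_at_eps_delta using e r by (auto simp: dist_real_def dest!: spec[of _ "e * r / 2"])
  obtain y where y: "y \<noteq> 0" "norm y < min s r" "w y < a + e * r / 2"
    using limit[of "e * r / 2" "min s r"] e r s by auto
  have "h y \<le> w' y" using \<open>\<And>y. y \<noteq> 0 \<Longrightarrow> norm y \<le> r \<Longrightarrow> h y \<le> w' y\<close> y by auto
  then have "h y + m \<bullet> y < e * r / 2" using y by (simp add: w'_def)
  moreover have "\<bar>h y + m \<bullet> y - e * r\<bar> < e * r / 2" using s(2)[of y] y h0 by simp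
  ultimately show False by (simp add: abs_if split: if_splits)
qed

text \<open>
  The argument of the Hopf boundary lemma. In coordinates centered at \<open>y\<close>, with \<open>e\<close> the unit vector
  towards \<open>p\<close>, the ball \<open>ball p D\<close> is the region \<open>e \<bullet> x > (norm x)\<^sup>2 / (2 * D)\<close>. The quadratic barrier \<open>h\<close>
  is strictly subharmonic, positive at \<open>y\<close>, and negative on the part of a small sphere around \<open>y\<close> that
  lies outside the ball. The points of this sphere with \<open>h \<ge> 0\<close> form a compact subset of the ball, on
  which \<open>w\<close> is bounded below by a positive constant. A small multiple of \<open>h\<close>
  therefore lies below \<open>w\<close> on the sphere, hence also at \<open>y\<close>.
\<close>

lemma hopf_touching:
  fixes w :: "'a::euclidean_space \<Rightarrow> real"
  assumes w: "dominates_subharmonic_on w S" "open S" "continuous_on S w" "\<And>x. x \<in> S \<Longrightarrow> 0 \<le> w x"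
    and pos: "ball p D \<subseteq> S" "\<And>x. x \<in> ball p D \<Longrightarrow> 0 < w x"
    and y: "y \<in> S" "dist p y = D" "0 < D"
  shows "0 < w y"
proof (rule ccontr)
  assume "\<not> 0 < w y"
  then have wy: "w y = 0" using w(4)[OF y(1)] by simp
  define n where "n = real DIM('a)"
  have n: "1 \<le> n" using DIM_positive[where 'a='a] by (simp add: n_def del: DIM_positive)
  \<comment> \<open>Makes the Laplacian of the barrier, \<open>2 * A - 4 * n / D\<close>, equal to \<open>A\<close>.\<close>
  define A where "A = 4 * n / D"
  have A: "0 < A" using n y by (simp add: A_def)
  define e where "e = (p - y) /\<^sub>R D"
  have e: "norm e = 1" "p = y + D *\<^sub>R e"
    using y by (simp_all add: e_def dist_norm)
  obtain s0 where s0: "s0 > 0" "cball y s0 \<subseteq> S" using w(2) y(1) open_contains_cball by blast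
  \<comment> \<open>On a sphere this small the term \<open>A * (e \<bullet> x)\<^sup>2\<close> is at most half of \<open>\<bar>e \<bullet> x\<bar>\<close>.\<close>
  define s where "s = min s0 (1 / (2 * A))"
  have s: "0 < s" "A * s \<le> 1 / 2" "cball y s \<subseteq> S"
  proof -
    show "0 < s" using s0 A by (simp add: s_def)
    have "A * s \<le> A * (1 / (2 * A))" unfolding s_def using A by (intro mult_left_mono) auto
    then show "A * s \<le> 1 / 2" using A by simp
    show "cball y s \<subseteq> S" using s0(2) by (auto simp: s_def)
  qed
  define h where "h = (\<lambda>x. (s\<^sup>2 / D - e \<bullet> y) + e \<bullet> x + A * (e \<bullet> (x - y))\<^sup>2 + (- (2 / D)) * (norm (x - y))\<^sup>2)"
  have hy: "h y = s\<^sup>2 / D" by (simp add: h_def)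
  have cont: "continuous_on X h" for X unfolding h_def by (intro continuous_intros)
  have outside: "h x < 0" if x: "dist y x = s" "x \<notin> ball p D" for x
  proof -
    define k where "k = e \<bullet> (x - y)"
    have nx: "norm (x - y) = s" using x by (simp add: dist_norm norm_minus_commute)
    have k: "\<bar>k\<bar> \<le> s" using Cauchy_Schwarz_ineq2[of e "x - y"] e nx by (simp add: k_def)
    have "A * \<bar>k\<bar> \<le> A * s" using k A by (intro mult_left_mono) auto
    from order_trans[OF this s(2)] have Ak: "\<bar>A * k\<bar> \<le> 1 / 2" using A by (simp add: abs_mult)
    have "D \<le> norm ((x - y) - D *\<^sub>R e)"
      using x(2) e(2) by (simp add: dist_norm norm_minus_commute algebra_simps)
    then have "D\<^sup>2 \<le> (norm ((x - y) - D *\<^sub>R e))\<^sup>2" using y by (intro power_mono) auto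
    also have "\<dots> = s\<^sup>2 - 2 * D * k + D\<^sup>2"
    proof -
      have "(norm ((x - y) - D *\<^sub>R e))\<^sup>2 = (norm (x - y))\<^sup>2 - 2 * D * k + D\<^sup>2 * (norm e)\<^sup>2"
        unfolding k_def power2_norm_eq_inner
        by (simp add: inner_diff_left inner_diff_right inner_commute algebra_simps power2_eq_square)
      then show ?thesis by (simp add: nx e)
    qed
    finally have kD: "k \<le> s\<^sup>2 / D / 2" using y by (simp add: field_simps)
    have hx: "h x = k + (A * k) * k - s\<^sup>2 / D"
    proof -
      have "h x = (s\<^sup>2 / D - e \<bullet> y) + e \<bullet> x + A * k\<^sup>2 + (- (2 / D)) * s\<^sup>2"
        unfolding h_def nx k_def[symmetric] ..
      moreover have "e \<bullet> x = k + e \<bullet> y" by (simp add: k_def inner_diff_right)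
      ultimately show ?thesis by (simp add: power2_eq_square)
    qed
    define G where "G = s\<^sup>2 / D"
    have sD: "0 < G" using s y by (simp add: G_def)
    note hx = hx[folded G_def] and kD = kD[folded G_def]
    show ?thesis
    proof (cases "0 \<le> k")
      case True
      have "(A * k) * k \<le> 1 / 2 * k" using Ak True by (intro mult_right_mono) auto
      then show ?thesis using hx kD sD by linarith
    next
      case False
      have "(A * k) * k \<le> (- 1 / 2) * k" using Ak False by (intro mult_right_mono_neg) auto
      then show ?thesis using hx sD False by linarith
    qed
  qed
  define T where "T = sphere y s \<inter> {x. 0 \<le> h x}"
  have "compact T"
    unfolding T_def using cont[of UNIV]
    by (intro compact_Int_closed compact_sphere closed_Collect_le continuous_on_const)
  have T: "x \<in> ball p D" if "x \<in> T" for x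
    using outside[of x] that by (force simp: T_def)
  have "\<exists>m>0. \<forall>x\<in>T. m \<le> w x"
  proof (cases "T = {}")
    case False
    have "continuous_on T w" using T pos(1) w(3) by (meson continuous_on_subset subsetI subsetD)
    then obtain x0 where "x0 \<in> T" "\<forall>x\<in>T. w x0 \<le> w x"
      using continuous_attains_inf[OF \<open>compact T\<close> False] by blast
    then show ?thesis using pos(2) T by blast
  qed (auto intro: exI[of _ 1])
  then obtain m where m: "0 < m" "\<And>x. x \<in> T \<Longrightarrow> m \<le> w x" by blast
  have "compact (h ` cball y s)" by (intro compact_continuous_image cont compact_cball)
  then obtain H where H: "H > 0" "\<And>x. x \<in> cball y s \<Longrightarrow> h x \<le> H"
    using compact_imp_bounded bounded_pos by (metis abs_le_D1 image_eqI real_norm_def)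
  define g where "g = (\<lambda>x. (m / H) * h x)"
  have "\<exists>L>0. has_laplacian g L x" for x
  proof -
    have "2 * A * (norm e)\<^sup>2 + 2 * (- (2 / D)) * n = A" using y by (simp add: e A_def)
    moreover have "has_laplacian h (2 * A * (norm e)\<^sup>2 + 2 * (- (2 / D)) * n) x"
      unfolding h_def n_def by (rule has_laplacian_quadratic)
    ultimately have "has_laplacian h A x" by simp
    then have "has_laplacian g (m / H * A) x" unfolding g_def by (rule has_laplacian_cmult)
    then show ?thesis using m H A by (intro exI[of _ "m / H * A"]) simp
  qed
  moreover have "g x \<le> w x" if x: "x \<in> cball y s - interior (cball y s)" for x
  proof (cases "x \<in> T")
    case True
    have "g x \<le> m" using H(2)[of x] H(1) m(1) x by (simp add: g_def field_simps)
    then show ?thesis using m(2)[OF True] by simp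
  next
    case False
    then have "h x < 0" using x by (auto simp: T_def interior_cball)
    then have "g x \<le> 0" using m(1) H(1) by (simp add: g_def divide_le_0_iff mult_le_0_iff)
    also have "0 \<le> w x" using x s by (intro w) auto
    finally show ?thesis .
  qed
  moreover have "continuous_on (cball y s) g" unfolding g_def by (intro continuous_intros cont)
  ultimately have "\<forall>x\<in>cball y s. g x \<le> w x"
    using w(1)[unfolded dominates_subharmonic_on_def, rule_format, of "cball y s" g] s(3)
    by simp
  then have "g y \<le> 0" using s(1) wy by (metis centre_in_cball less_imp_le)
  moreover have "0 < g y" using hy m(1) H(1) s(1) y(3) by (simp add: g_def)
  ultimately show False by simp
qed

text \<open>
  The zero set is open: otherwise a point of positivity near a zero has a nearest zero \<open>y1\<close>, and
  the open ball up to \<open>y1\<close> consists of points of positivity, which \<open>hopf_touching\<close> forbids. By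
  connectedness one zero forces \<open>w\<close> to vanish.
\<close>

lemma strong_minimum_principle:
  fixes w :: "'a::euclidean_space \<Rightarrow> real"
  assumes w: "dominates_subharmonic_on w S" "open S" "connected S" "continuous_on S w"
      "\<And>x. x \<in> S \<Longrightarrow> 0 \<le> w x"
    and z: "z \<in> S" "w z = 0" and x: "x \<in> S"
  shows "w x = 0"
proof -
  define P where "P = {x \<in> S. 0 < w x}"
  define Z where "Z = {x \<in> S. w x = 0}"
  have "open P"
  proof -
    have "P = S \<inter> w -` {0<..}" by (auto simp: P_def)
    then show ?thesis using w continuous_open_preimage open_greaterThan by metis
  qed
  moreover have "open Z"
    unfolding open_contains_ball
  proof (rule ballI, rule ccontr)
    fix y assume y: "y \<in> Z" and n: "\<not> (\<exists>e>0. ball y e \<subseteq> Z)"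
    then obtain d0 where d0: "d0 > 0" "cball y d0 \<subseteq> S"
      using w(2) open_contains_cball by (metis (mono_tags, lifting) Z_def mem_Collect_eq)
    define d where "d = d0 / 2"
    have d: "d > 0" "cball y (2 * d) \<subseteq> S" using d0 by (auto simp: d_def)
    obtain p where p: "p \<in> ball y d" "p \<notin> Z" using n d by blast
    then have "p \<in> S" using d by auto
    define Z' where "Z' = cball y (2 * d) \<inter> w -` {0}"
    have "closed Z'" unfolding Z'_def
      using continuous_closed_preimage[of "cball y (2 * d)" w "{0}"] w(4) d(2) continuous_on_subset
      by auto
    moreover have "y \<in> Z'" using y d by (simp add: Z'_def Z_def)
    ultimately obtain y1 where y1: "y1 \<in> Z'" "\<And>y. y \<in> Z' \<Longrightarrow> dist p y1 \<le> dist p y"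
      using distance_attains_inf[of Z' p] by blast
    define D where "D = dist p y1"
    have D: "D < d" using y1(2)[OF \<open>y \<in> Z'\<close>] p by (simp add: D_def dist_commute)
    have near: "ball p D \<subseteq> cball y (2 * d)"
    proof
      fix v assume "v \<in> ball p D"
      then show "v \<in> cball y (2 * d)"
        using dist_triangle[of y v p] p D by simp
    qed
    have "0 < w y1"
    proof (rule hopf_touching[OF w(1,2,4,5)])
      show "ball p D \<subseteq> S" using near d by blast
      show "0 < w v" if "v \<in> ball p D" for v
      proof -
        have "v \<notin> Z'" using y1(2)[of v] that by (auto simp: D_def)
        then have "w v \<noteq> 0" using near that by (auto simp: Z'_def)
        moreover have "0 \<le> w v" using near that d w(5) by blast
        ultimately show ?thesis by simp
      qed
      show "y1 \<in> S" using y1(1) d by (auto simp: Z'_def)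
      show "dist p y1 = D" by (simp add: D_def)
      have "p \<noteq> y1" using p y1(1) \<open>p \<in> S\<close> by (auto simp: Z'_def Z_def)
      then show "0 < D" by (simp add: D_def)
    qed
    then show False using y1(1) by (simp add: Z'_def)
  qed
  moreover have "S \<subseteq> P \<union> Z" "P \<inter> Z \<inter> S = {}"
    using w(5) by (auto simp: P_def Z_def less_le)
  ultimately have "P \<inter> S = {} \<or> Z \<inter> S = {}" using w(3) connectedD by blast
  then have "P = {}" using z by (auto simp: P_def Z_def)
  then show ?thesis using x w(5)[OF x] by (auto simp: P_def less_le)
qed

text \<open>
  If \<open>w\<close> had a positive minimum \<open>m\<close> on some sphere around the origin, comparison with a quadratic
  polynomial between \<open>m / 2\<close> and \<open>m\<close> would keep \<open>w\<close> above \<open>m / 2\<close> inside, against \<open>limit\<close>. So \<open>w\<close>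
  has a zero, and the strong minimum principle applies because the punctured ball is connected in
  dimension at least two.
\<close>

lemma punctured_ball_rigidity:
  fixes w :: "'a::euclidean_space \<Rightarrow> real"
  assumes dim: "2 \<le> DIM('a)" and R: "0 < R"
    and w: "dominates_subharmonic_on w (ball 0 R - {0})" "continuous_on (ball 0 R - {0}) w"
      "\<And>x. x \<in> ball 0 R - {0} \<Longrightarrow> 0 \<le> w x"
    and limit: "\<And>e r. e > 0 \<Longrightarrow> r > 0 \<Longrightarrow> \<exists>y. y \<noteq> 0 \<and> norm y < r \<and> w y < e"
    and x: "x \<in> ball 0 R - {0}"
  shows "w x = 0"
proof -
  define r where "r = R / 2"
  have r: "0 < r" "r < R" using R by (auto simp: r_def)
  have sub: "sphere 0 r \<subseteq> ball (0::'a) R - {0}" using r by auto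
  have "sphere (0::'a) r \<noteq> {}" using r by simp
  then obtain z where z: "z \<in> sphere 0 r" "\<And>y. y \<in> sphere 0 r \<Longrightarrow> w z \<le> w y"
    using continuous_attains_inf[OF compact_sphere _ continuous_on_subset[OF w(2) sub]] by blast
  define m where "m = w z"
  have "m = 0"
  proof (rule ccontr)
    assume "m \<noteq> 0"
    then have m: "0 < m" using w(3)[of z] z(1) sub by (force simp: m_def)
    define h where "h = (\<lambda>y::'a. m / 2 + 0 \<bullet> y + 0 * (0 \<bullet> (y - 0))\<^sup>2 + (m / (2 * r\<^sup>2)) * (norm (y - 0))\<^sup>2)"
    obtain y where y: "y \<noteq> 0" "norm y < r" "w y < m / 2" using limit[of "m / 2" r] m r by auto
    have "h y \<le> w y"
    proof (rule punctured_ball_comparison[OF dim w(1) r, where M = 0])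
      show "continuous_on UNIV h" unfolding h_def by (intro continuous_intros)
      have "has_laplacian h (2 * 0 * (norm (0::'a))\<^sup>2 + 2 * (m / (2 * r\<^sup>2)) * real DIM('a)) x" for x
        unfolding h_def by (rule has_laplacian_quadratic)
      moreover have "0 < 2 * 0 * (norm (0::'a))\<^sup>2 + 2 * (m / (2 * r\<^sup>2)) * real DIM('a)" using m r by simp
      ultimately show "\<exists>L>0. has_laplacian h L x" for x by blast
      show "h x \<le> w x" if "norm x = r" for x
        using z(2)[of x] that r by (simp add: h_def m_def field_simps)
      show "0 \<le> w x" if "x \<noteq> 0" "norm x < r" for x using that r by (intro w(3)) auto
    qed (use y in auto)
    moreover have "m / 2 \<le> h y" using m r by (simp add: h_def)
    ultimately show False using y(3) by linarith
  qed
  then show ?thesis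
    using strong_minimum_principle[OF w(1) open_delete[OF open_ball]
        connected_punctured_ball[OF dim] w(2,3) _ _ x, of z] z(1) sub
    unfolding m_def by blast
qed

section \<open>Sliding a family of minorants\<close>

lemma Liminf_nonpos_approach:
  fixes f :: "'a::real_normed_vector \<Rightarrow> real"
  assumes "\<not> 0 < Liminf (at 0) (\<lambda>y. ereal (f y))" "0 < e" "0 < r"
  shows "\<exists>y. y \<noteq> 0 \<and> norm y < r \<and> f y < e"
proof (rule ccontr)
  assume n: "\<not> ?thesis"
  have "\<forall>\<^sub>F y in at 0. ereal e \<le> ereal (f y)"
    unfolding eventually_at using n assms(3) by (intro exI[of _ r]) force
  then have "ereal e \<le> Liminf (at 0) (\<lambda>y. ereal (f y))" by (rule Liminf_bounded)
  moreover have "0 < ereal e" using assms(2) by simp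
  ultimately show False using assms(1) by (meson less_le_trans)
qed

lemma INF_ereal_eq_0:
  fixes f :: "'a \<Rightarrow> real"
  assumes "\<And>y. y \<in> Y \<Longrightarrow> 0 \<le> f y" "\<And>e. e > 0 \<Longrightarrow> \<exists>y\<in>Y. f y < e"
  shows "(INF y\<in>Y. ereal (f y)) = 0"
proof (rule antisym)
  show "0 \<le> (INF y\<in>Y. ereal (f y))" by (rule INF_greatest) (use assms(1) in simp)
  show "(INF y\<in>Y. ereal (f y)) \<le> 0"
  proof (rule ereal_le_epsilon2)
    fix e :: real assume "0 < e"
    then obtain y where "y \<in> Y" "f y < e" using assms(2) by blast
    then show "(INF y\<in>Y. ereal (f y)) \<le> 0 + ereal e" by (intro INF_lower2[of y]) auto
  qed
qed

text \<open>
  The supremum of the admissible parameters. The Lipschitz bound, uniform in \<open>y\<close>, makes the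
  supremum admissible and forces the gap to have infimum zero: with a positive gap the parameter could
  be raised further.
\<close>

lemma maximal_parameter_below:
  fixes f :: "real \<Rightarrow> 'a \<Rightarrow> real"
  assumes ab: "a \<le> b"
    and lip: "\<And>s t y. a \<le> s \<Longrightarrow> s \<le> t \<Longrightarrow> t \<le> b \<Longrightarrow> y \<in> Y \<Longrightarrow> f t y - f s y \<le> C * (t - s)"
    and lo: "\<And>y. y \<in> Y \<Longrightarrow> f a y \<le> u y" and hi: "\<exists>y\<in>Y. u y < f b y"
  shows "\<exists>t. a \<le> t \<and> t \<le> b \<and> (\<forall>y\<in>Y. f t y \<le> u y) \<and> (\<forall>e>0. \<exists>y\<in>Y. u y < f t y + e)"
proof -
  define \<Lambda> where "\<Lambda> = {t. a \<le> t \<and> t \<le> b \<and> (\<forall>y\<in>Y. f t y \<le> u y)}"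
  have a: "a \<in> \<Lambda>" using ab lo by (simp add: \<Lambda>_def)
  have bdd: "bdd_above \<Lambda>" unfolding bdd_above_def \<Lambda>_def by blast
  define t where "t = Sup \<Lambda>"
  have t: "a \<le> t" "t \<le> b"
    unfolding t_def using a bdd by (auto intro: cSup_upper cSup_least simp: \<Lambda>_def)
  define C' where "C' = max C 1"
  have C': "0 < C'" "C \<le> C'" by (auto simp: C'_def)
  have lip': "f t y - f s y \<le> C' * (t - s)" if "a \<le> s" "s \<le> t" "t \<le> b" "y \<in> Y" for s t y
    using lip[OF that] mult_right_mono[OF C'(2), of "t - s"] that by linarith
  have below: "f t y \<le> u y" if y: "y \<in> Y" for y
  proof (rule field_le_epsilon)
    fix e :: real assume e: "0 < e"
    then have "t - e / C' < Sup \<Lambda>" using C' by (simp add: t_def)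
    then obtain s where s: "s \<in> \<Lambda>" "t - e / C' < s" using a less_cSupD by (metis empty_iff)
    have "s \<le> t" unfolding t_def using s bdd by (intro cSup_upper)
    then have "f t y \<le> f s y + C' * (t - s)" using lip'[of s t y] s t y by (auto simp: \<Lambda>_def)
    also have "f s y \<le> u y" using s y by (simp add: \<Lambda>_def)
    also have "C' * (t - s) \<le> C' * (e / C')" using s C' by (intro mult_left_mono) auto
    finally show "f t y \<le> u y + e" using C' by simp
  qed
  have "t \<noteq> b" using below hi by force
  have "\<exists>y\<in>Y. u y < f t y + e" if e: "e > 0" for e
  proof -
    define s where "s = min b (t + e / (2 * C'))"
    have s: "t < s" "s \<le> b" "s - t \<le> e / (2 * C')" using t \<open>t \<noteq> b\<close> e C' by (auto simp: s_def)
    have "s \<notin> \<Lambda>" using s(1) cSup_upper[OF _ bdd, of s] by (auto simp: t_def)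
    then obtain y where y: "y \<in> Y" "u y < f s y" using s t by (force simp: \<Lambda>_def)
    have "f s y - f t y \<le> C' * (s - t)" using lip'[of t s y] s t y by simp
    also have "\<dots> \<le> C' * (e / (2 * C'))" using s C' by (intro mult_left_mono) auto
    also have "\<dots> < e" using C' e by simp
    finally show ?thesis using y by (intro bexI[of _ y]) auto
  qed
  then show ?thesis using t below by blast
qed

text \<open>
  Along points approaching the origin at which \<open>u\<close> is barely above \<open>g\<close>, the minorant \<open>f\<close> is
  squeezed below \<open>g\<close> as well. With the roles exchanged this identifies the values at \<open>0\<close> of two
  minorants that both approach \<open>u\<close>.
\<close>

lemma common_limit_of_minorants:
  fixes f g u :: "'a::real_normed_vector \<Rightarrow> real"
  assumes cont: "isCont f 0" "isCont g 0" and R: "0 < R"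
    and le: "\<And>y. y \<noteq> 0 \<Longrightarrow> norm y < R \<Longrightarrow> f y \<le> u y"
    and g: "\<And>e r. e > 0 \<Longrightarrow> r > 0 \<Longrightarrow> \<exists>y. y \<noteq> 0 \<and> norm y < r \<and> u y < g y + e"
  shows "f 0 \<le> g 0"
proof (rule ccontr)
  assume "\<not> f 0 \<le> g 0"
  define e where "e = (f 0 - g 0) / 4"
  have e: "0 < e" using \<open>\<not> f 0 \<le> g 0\<close> by (simp add: e_def)
  obtain r1 r2 where r: "r1 > 0" "\<And>y. norm y < r1 \<Longrightarrow> \<bar>f y - f 0\<bar> < e"
    "r2 > 0" "\<And>y. norm y < r2 \<Longrightarrow> \<bar>g y - g 0\<bar> < e"
    using cont e unfolding continuous_at_eps_delta dist_real_def by (metis diff_zero dist_norm)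
  obtain y where y: "y \<noteq> 0" "norm y < min R (min r1 r2)" "u y < g y + e"
    using g[OF e, of "min R (min r1 r2)"] r R by auto
  have "f 0 - e < f y" "g y < g 0 + e" "f y \<le> u y"
    using r(2)[of y] r(4)[of y] le[OF y(1)] y(2) by (simp_all add: abs_less_iff)
  moreover have "f 0 - g 0 = 4 * e" by (simp add: e_def)
  ultimately show False using y(3) e by linarith
qed

text \<open>
  Near the origin each differentiable minorant is its affine part up to \<open>o(norm y)\<close>, so
  two of them with a common value and different gradients would form a convex corner.
\<close>

lemma minorant_gradients_agree:
  fixes w f g :: "'a::euclidean_space \<Rightarrow> real"
  assumes dim: "2 \<le> DIM('a)" and R: "0 < R"
    and w: "dominates_subharmonic_on w (ball 0 R - {0})"
    and f: "(f has_derivative (\<lambda>h. p \<bullet> h)) (at 0)" "\<And>y. y \<noteq> 0 \<Longrightarrow> norm y < R \<Longrightarrow> f y \<le> w y"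
    and g: "(g has_derivative (\<lambda>h. p' \<bullet> h)) (at 0)" "\<And>y. y \<noteq> 0 \<Longrightarrow> norm y < R \<Longrightarrow> g y \<le> w y"
    and limit: "\<And>e r. e > 0 \<Longrightarrow> r > 0 \<Longrightarrow> \<exists>y. y \<noteq> 0 \<and> norm y < r \<and> w y < f y + e"
    and eq: "f 0 = g 0"
  shows "p = p'"
proof (rule supporting_gradient_unique[OF dim R w, where a = "f 0"])
  have lower: "\<exists>r>0. \<forall>y. y \<noteq> 0 \<and> norm y < r \<longrightarrow> k 0 + q \<bullet> y - e * norm y \<le> w y"
    if k: "(k has_derivative (\<lambda>h. q \<bullet> h)) (at 0)" "\<And>y. y \<noteq> 0 \<Longrightarrow> norm y < R \<Longrightarrow> k y \<le> w y"
      and e: "e > 0" for k q e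
  proof -
    obtain d where d: "d > 0" "\<And>y. norm y < d \<Longrightarrow> \<bar>k y - k 0 - q \<bullet> y\<bar> \<le> e * norm y"
      using k(1) e unfolding has_derivative_at_alt by auto
    have "k 0 + q \<bullet> y - e * norm y \<le> w y" if "y \<noteq> 0" "norm y < min d R" for y
      using d(2)[of y] k(2)[of y] that by (simp add: abs_le_iff)
    then show ?thesis using d R by (intro exI[of _ "min d R"]) auto
  qed
  show "\<exists>r>0. \<forall>y. y \<noteq> 0 \<and> norm y < r \<longrightarrow> f 0 + p \<bullet> y - e * norm y \<le> w y" if "e > 0" for e
    using lower[OF f that] .
  show "\<exists>r>0. \<forall>y. y \<noteq> 0 \<and> norm y < r \<longrightarrow> f 0 + p' \<bullet> y - e * norm y \<le> w y" if "e > 0" for e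
    using lower[OF g that] eq by simp
  show "\<exists>y. y \<noteq> 0 \<and> norm y < r \<and> w y < f 0 + e" if "e > 0" "r > 0" for e r
  proof -
    have "\<exists>d>0. \<forall>y. dist y 0 < d \<longrightarrow> dist (f y) (f 0) < e / 2"
      using has_derivative_continuous[OF f(1)] half_gt_zero[OF \<open>e > 0\<close>]
      unfolding continuous_at_eps_delta by blast
    then obtain d where d: "d > 0" "\<And>y. norm y < d \<Longrightarrow> \<bar>f y - f 0\<bar> < e / 2"
      by (auto simp: dist_real_def)
    obtain y where y: "y \<noteq> 0" "norm y < min d r" "w y < f y + e / 2"
      using limit[of "e / 2" "min d r"] d(1) \<open>e > 0\<close> \<open>r > 0\<close> by auto
    have "f y < f 0 + e / 2" using d(2)[of y] y(2) unfolding abs_diff_less_iff by simp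
    then have "w y < f 0 + e" using y(3) by linarith
    then show ?thesis using y by auto
  qed
qed

text \<open>
  Along the segment from \<open>0\<close> to \<open>y\<close> the derivative of \<open>v\<close> is \<open>(p \<bullet> y) / P\<close> with \<open>P > 0\<close>, so it has
  the sign of \<open>p \<bullet> y\<close>, and \<open>v - v 0\<close> acquires the same sign. The hypothesis on \<open>P\<close> then says that in
  both cases the derivative exceeds \<open>p \<bullet> y\<close>. Two applications of the mean value theorem make this
  precise: one for the sign, one for the value at \<open>y\<close>.
\<close>

lemma above_tangent_plane:
  fixes v :: "'a::euclidean_space \<Rightarrow> real"
  assumes v: "\<And>x. norm x < r \<Longrightarrow> (v has_derivative (\<lambda>h. G x \<bullet> h)) (at x)"
    and P: "\<And>x. norm x < r \<Longrightarrow> \<exists>P>0. P *\<^sub>R G x = p \<and> (v x > v 0 \<longrightarrow> P < 1) \<and> (v x < v 0 \<longrightarrow> P > 1)"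
    and y: "norm y < r"
  shows "v 0 + p \<bullet> y \<le> v y" "p \<bullet> y \<noteq> 0 \<Longrightarrow> v 0 + p \<bullet> y < v y"
proof -
  define h where "h = (\<lambda>t. v (t *\<^sub>R y))"
  have small: "norm (t *\<^sub>R y) < r" if "0 \<le> t" "t \<le> 1" for t
    using mult_right_mono[of t 1 "norm y"] that y by simp
  have h: "(h has_real_derivative G (t *\<^sub>R y) \<bullet> y) (at t)" if "0 \<le> t" "t \<le> 1" for t
  proof -
    have "((\<lambda>t. t *\<^sub>R y) has_derivative (\<lambda>s. s *\<^sub>R y)) (at t)" by (auto intro!: derivative_eq_intros)
    from has_derivative_compose[OF this v[OF small[OF that]]]
    show ?thesis by (simp add: h_def has_field_derivative_def mult.commute[of _ "G (t *\<^sub>R y) \<bullet> y"])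
  qed
  define s where "s = p \<bullet> y"
  have rate: "\<exists>P>0. G (t *\<^sub>R y) \<bullet> y = s / P \<and> (h t > v 0 \<longrightarrow> P < 1) \<and> (h t < v 0 \<longrightarrow> P > 1)"
    if "0 \<le> t" "t \<le> 1" for t
  proof -
    obtain P where P': "P > 0" "P *\<^sub>R G (t *\<^sub>R y) = p" "v (t *\<^sub>R y) > v 0 \<longrightarrow> P < 1"
      "v (t *\<^sub>R y) < v 0 \<longrightarrow> P > 1"
      using P[OF small[OF \<open>0 \<le> t\<close> \<open>t \<le> 1\<close>]] by blast
    have "P * (G (t *\<^sub>R y) \<bullet> y) = s" unfolding s_def P'(2)[symmetric] by simp
    then have "G (t *\<^sub>R y) \<bullet> y = s / P" using P'(1) by (simp add: field_simps)
    then show ?thesis using P' by (auto simp: h_def)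
  qed
  obtain z where z: "0 < z" "z < 1" "h 1 - h 0 = G (z *\<^sub>R y) \<bullet> y"
    using MVT2[of 0 1 h "\<lambda>t. G (t *\<^sub>R y) \<bullet> y"] h by auto
  obtain z' where z': "0 < z'" "z' < z" "h z - h 0 = z * (G (z' *\<^sub>R y) \<bullet> y)"
    using MVT2[of 0 z h "\<lambda>t. G (t *\<^sub>R y) \<bullet> y"] h z by auto
  obtain P where P: "P > 0" "h 1 - h 0 = s / P" "h z > v 0 \<longrightarrow> P < 1" "h z < v 0 \<longrightarrow> P > 1"
    using rate[of z] z by auto
  obtain P' where P': "P' > 0" "h z - h 0 = z * (s / P')"
  proof -
    obtain P' where "P' > 0" "G (z' *\<^sub>R y) \<bullet> y = s / P'"
      using rate[of z'] z' z by fastforce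
    then show ?thesis using that z'(3) by simp
  qed
  have h01: "h 0 = v 0" "h 1 = v y" by (simp_all add: h_def)
  have strict: "s < s / P" if "s \<noteq> 0"
  proof (cases "s > 0")
    case True
    then have "0 < h z - h 0" unfolding P'(2) using z P' by simp
    then have "P < 1" using P(3) h01 by simp
    then show ?thesis using True P(1) by (simp add: less_divide_eq)
  next
    case False
    then have "h z - h 0 < 0" unfolding P'(2) using z P'(1) that by (simp add: mult_less_0_iff divide_less_0_iff)
    then have "P > 1" using P(4) h01 by simp
    then show ?thesis using False P(1) that by (simp add: less_divide_eq)
  qed
  show "v 0 + p \<bullet> y < v y" if "p \<bullet> y \<noteq> 0"
    using strict P(2) that h01 by (simp add: s_def)
  then show "v 0 + p \<bullet> y \<le> v y"
    using P(2) h01 by (cases "p \<bullet> y = 0") (auto simp: s_def)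
qed

lemma Ck1_has_gradient:
  assumes "Ck_on 1 v U" "x \<in> U"
  shows "(v has_derivative (\<lambda>h. gradient v x \<bullet> h)) (at x)"
proof -
  have d: "(v has_derivative frechet_derivative v (at x)) (at x)"
    using assms by (simp add: frechet_derivative_works)
  interpret linear "frechet_derivative v (at x)" using d has_derivative_linear by blast
  have "frechet_derivative v (at x) h = gradient v x \<bullet> h" for h
  proof -
    have "frechet_derivative v (at x) h = frechet_derivative v (at x) (\<Sum>b\<in>Basis. (h \<bullet> b) *\<^sub>R b)"
      by (simp add: euclidean_representation)
    also have "\<dots> = (\<Sum>b\<in>Basis. (h \<bullet> b) * partial b v x)" by (simp add: sum scaleR partial_def)
    also have "\<dots> = gradient v x \<bullet> h"
      by (simp add: gradient_def inner_sum_left inner_commute[of h] mult.commute)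
    finally show ?thesis .
  qed
  then show ?thesis using d by (metis ext)
qed

lemma Ck1_continuous:
  assumes "Ck_on 1 v U"
  shows "continuous_on U v" "continuous_on U (gradient v)"
proof -
  show "continuous_on U v"
    using assms by (intro continuous_at_imp_continuous_on) (auto intro: differentiable_imp_continuous_within)
  show "continuous_on U (gradient v)"
    unfolding gradient_def[abs_def] using assms by (auto intro!: continuous_intros)
qed

lemma C1_differentiable_deriv:
  fixes f :: "real \<Rightarrow> real"
  assumes "f C1_differentiable_on I"
  shows "t \<in> I \<Longrightarrow> (f has_real_derivative deriv f t) (at t)" "continuous_on I (deriv f)" "continuous_on I f"
proof -
  obtain D where D: "\<And>t. t \<in> I \<Longrightarrow> (f has_real_derivative D t) (at t)" "continuous_on I D"
    using assms unfolding C1_differentiable_on_def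
    by (auto simp: has_real_derivative_iff_has_vector_derivative)
  have eq: "deriv f t = D t" if "t \<in> I" for t using D(1)[OF that] by (rule DERIV_imp_deriv)
  show "(f has_real_derivative deriv f t) (at t)" if "t \<in> I" using D(1) eq that by simp
  show "continuous_on I (deriv f)" using D(2) eq by (simp cong: continuous_on_cong)
  show "continuous_on I f" using D(1) DERIV_isCont continuous_at_imp_continuous_on by blast
qed

text \<open>
  The derivative of \<open>Phi\<close> with respect to the parameter.
\<close>

definition Phi_rate ::
    "(real \<Rightarrow> real) \<Rightarrow> (real \<Rightarrow> real) \<Rightarrow> (real \<Rightarrow> real) \<Rightarrow>
     ('a::euclidean_space \<Rightarrow> real) \<Rightarrow> 'a \<Rightarrow> real \<Rightarrow> 'a \<Rightarrow> real" where
  "Phi_rate \<phi> \<xi> \<psi> v x t y = deriv \<phi> t * v (x + \<xi> t *\<^sub>R y) +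
     \<phi> t * (deriv \<xi> t * (gradient v (x + \<xi> t *\<^sub>R y) \<bullet> y)) + deriv \<psi> t"

lemma Phi_has_derivative_param:
  fixes v :: "'a::euclidean_space \<Rightarrow> real"
  assumes "\<phi> C1_differentiable_on I" "\<xi> C1_differentiable_on I" "\<psi> C1_differentiable_on I"
    and "Ck_on 1 v U" "t \<in> I" "x + \<xi> t *\<^sub>R y \<in> U"
  shows "((\<lambda>t. Phi \<phi> \<xi> \<psi> v x t y) has_real_derivative Phi_rate \<phi> \<xi> \<psi> v x t y) (at t)"
proof -
  have "((\<lambda>t. x + \<xi> t *\<^sub>R y) has_derivative (\<lambda>s. (deriv \<xi> t * s) *\<^sub>R y)) (at t)"
    using C1_differentiable_deriv(1)[OF assms(2,5)] unfolding has_field_derivative_def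
    by (auto intro!: derivative_eq_intros)
  from has_derivative_compose[OF this Ck1_has_gradient[OF assms(4,6)]]
  have "((\<lambda>t. v (x + \<xi> t *\<^sub>R y)) has_real_derivative
      deriv \<xi> t * (gradient v (x + \<xi> t *\<^sub>R y) \<bullet> y)) (at t)"
    unfolding has_field_derivative_def by (rule has_derivative_eq_rhs) (simp add: fun_eq_iff mult_ac)
  from DERIV_add[OF DERIV_mult[OF C1_differentiable_deriv(1)[OF assms(1,5)] this]
      C1_differentiable_deriv(1)[OF assms(3,5)]]
  show ?thesis unfolding Phi_def Phi_rate_def by (simp add: algebra_simps)
qed

lemma Phi_has_derivative_space:
  fixes v :: "'a::euclidean_space \<Rightarrow> real"
  assumes "Ck_on 1 v U" "x \<in> U"
  shows "(Phi \<phi> \<xi> \<psi> v x t has_derivative (\<lambda>h. ((\<phi> t * \<xi> t) *\<^sub>R gradient v x) \<bullet> h)) (at 0)"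
proof -
  have 1: "((\<lambda>y. x + \<xi> t *\<^sub>R y) has_derivative (\<lambda>h. \<xi> t *\<^sub>R h)) (at 0)"
    by (auto intro!: derivative_eq_intros)
  have "(v has_derivative (\<lambda>h. gradient v x \<bullet> h)) (at (x + \<xi> t *\<^sub>R 0))"
    using Ck1_has_gradient[OF assms] by simp
  from has_derivative_compose[OF 1 this]
  have "((\<lambda>y. v (x + \<xi> t *\<^sub>R y)) has_derivative (\<lambda>h. gradient v x \<bullet> (\<xi> t *\<^sub>R h))) (at 0)" .
  from has_derivative_add[OF has_derivative_mult_right[OF this, of "\<phi> t"] has_derivative_const[of "\<psi> t"]]
  show ?thesis unfolding Phi_def[abs_def] by (simp add: mult.assoc)
qed

text \<open>
  The rate is jointly continuous in \<open>(x, t, y)\<close> on an open set that contains the compact set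
  \<open>{(0, 1)} \<times> Y\<close>, where it is positive. A compact product neighborhood of that set still lies in the
  region of positivity, and the bounds are the extreme values there.
\<close>

lemma Phi_rate_uniformly_positive:
  fixes v :: "'a::euclidean_space \<Rightarrow> real"
  assumes Y: "compact Y" "Y \<noteq> {}" and U: "open U" "Y \<subseteq> U" "Ck_on 1 v U"
    and I: "open I" "1 \<in> I" "\<phi> C1_differentiable_on I" "\<xi> C1_differentiable_on I" "\<psi> C1_differentiable_on I"
    and at_1: "\<xi> 1 = 1"
    and pos: "\<And>y. y \<in> Y \<Longrightarrow> 0 < Phi_rate \<phi> \<xi> \<psi> v 0 1 y"
  shows "\<exists>e>0. \<exists>c>0. \<exists>C. \<forall>x t y. norm x \<le> e \<and> \<bar>t - 1\<bar> \<le> e \<and> y \<in> Y \<longrightarrow>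
    t \<in> I \<and> x + \<xi> t *\<^sub>R y \<in> U \<and> c \<le> Phi_rate \<phi> \<xi> \<psi> v x t y \<and> Phi_rate \<phi> \<xi> \<psi> v x t y \<le> C"
proof -
  define f where "f = (\<lambda>z :: ('a \<times> real) \<times> 'a. fst (fst z) + \<xi> (snd (fst z)) *\<^sub>R snd z)"
  define H where "H = (\<lambda>z :: ('a \<times> real) \<times> 'a. Phi_rate \<phi> \<xi> \<psi> v (fst (fst z)) (snd (fst z)) (snd z))"
  define A where "A = (\<lambda>z :: ('a \<times> real) \<times> 'a. snd (fst z)) -` I"
  have A: "open A" unfolding A_def by (intro open_vimage I continuous_intros)
  have A_cont: "continuous_on A (\<lambda>z. g (snd (fst z)))" if "continuous_on I g" for g :: "real \<Rightarrow> real"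
    by (rule continuous_on_compose2[OF that]) (auto simp: A_def intro!: continuous_intros)
  have f: "continuous_on A f"
    unfolding f_def using A_cont[OF C1_differentiable_deriv(3)[OF I(4)]] by (intro continuous_intros) auto
  define W where "W = A \<inter> f -` U"
  have W: "open W" unfolding W_def using continuous_open_preimage[OF f A U(1)] .
  have U_cont: "continuous_on W (\<lambda>z. g (f z))" if "continuous_on U g" for g :: "'a \<Rightarrow> 'b::topological_space"
    by (rule continuous_on_compose2[OF that continuous_on_subset[OF f]]) (auto simp: W_def)
  have H: "continuous_on W H"
  proof -
    have W_cont: "continuous_on W (\<lambda>z. g (snd (fst z)))" if "continuous_on I g" for g :: "real \<Rightarrow> real"
      using continuous_on_subset[OF A_cont[OF that]] by (simp add: W_def)
    have "H = (\<lambda>z. deriv \<phi> (snd (fst z)) * v (f z) +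
        \<phi> (snd (fst z)) * (deriv \<xi> (snd (fst z)) * (gradient v (f z) \<bullet> snd z)) + deriv \<psi> (snd (fst z)))"
      by (simp add: H_def Phi_rate_def f_def)
    moreover have "continuous_on W (\<lambda>z. deriv \<phi> (snd (fst z)) * v (f z) +
        \<phi> (snd (fst z)) * (deriv \<xi> (snd (fst z)) * (gradient v (f z) \<bullet> snd z)) + deriv \<psi> (snd (fst z)))"
      by (intro continuous_on_add continuous_on_mult continuous_on_inner U_cont W_cont
          Ck1_continuous[OF U(3)] C1_differentiable_deriv[OF I(3)] C1_differentiable_deriv[OF I(4)]
          C1_differentiable_deriv[OF I(5)] continuous_on_snd continuous_on_id)
    ultimately show ?thesis by simp
  qed
  define V where "V = W \<inter> H -` {0<..}"
  have "open V" unfolding V_def using continuous_open_preimage[OF H W open_greaterThan] .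
  moreover have "compact ({(0, 1)} \<times> Y)" using Y by (intro compact_Times) auto
  moreover have "{(0, 1)} \<times> Y \<subseteq> V"
  proof
    fix z :: "('a \<times> real) \<times> 'a" assume "z \<in> {(0, 1)} \<times> Y"
    then obtain y where "z = ((0, 1), y)" "y \<in> Y" by blast
    moreover have "y \<in> U" using U(2) \<open>y \<in> Y\<close> by blast
    ultimately show "z \<in> V"
      using pos[of y] I(2) at_1 by (simp add: V_def W_def A_def f_def H_def)
  qed
  ultimately obtain d where d: "d > 0" "{z. infdist z ({(0, 1)} \<times> Y) \<le> d} \<subseteq> V"
    using compact_in_open_separated[of "{(0, 1)} \<times> Y" V] Y by auto
  define e where "e = d / 2"
  have e: "e > 0" using d by (simp add: e_def)
  define Q where "Q = (cball (0::'a) e \<times> cball (1::real) e) \<times> Y"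
  have "Q \<subseteq> V"
  proof
    fix z assume "z \<in> Q"
    then obtain x t y where z: "z = ((x, t), y)" "norm x \<le> e" "\<bar>t - 1\<bar> \<le> e" "y \<in> Y"
      by (auto simp: Q_def dist_real_def abs_minus_commute)
    have "infdist z ({(0, 1)} \<times> Y) \<le> dist z ((0, 1), y)" using z by (intro infdist_le) auto
    also have "\<dots> = dist (x, t) (0, 1)" by (simp add: z dist_Pair_Pair)
    also have "\<dots> \<le> norm x + \<bar>t - 1\<bar>"
      unfolding dist_Pair_Pair using sqrt_sum_squares_le_sum_abs[of "dist x 0" "dist t 1"]
      by (simp add: dist_real_def)
    also have "\<dots> \<le> d" using z by (simp add: e_def)
    finally show "z \<in> V" using d by auto
  qed
  have Q: "compact Q" "Q \<noteq> {}" using Y e by (auto simp: Q_def intro!: compact_Times)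
  have HQ: "continuous_on Q H" using H \<open>Q \<subseteq> V\<close> by (auto simp: V_def intro: continuous_on_subset)
  obtain z0 where z0: "z0 \<in> Q" "\<And>z. z \<in> Q \<Longrightarrow> H z0 \<le> H z" using continuous_attains_inf[OF Q HQ] by blast
  obtain z1 where z1: "z1 \<in> Q" "\<And>z. z \<in> Q \<Longrightarrow> H z \<le> H z1" using continuous_attains_sup[OF Q HQ] by blast
  have "t \<in> I \<and> x + \<xi> t *\<^sub>R y \<in> U \<and> H z0 \<le> Phi_rate \<phi> \<xi> \<psi> v x t y \<and> Phi_rate \<phi> \<xi> \<psi> v x t y \<le> H z1"
    if "norm x \<le> e \<and> \<bar>t - 1\<bar> \<le> e \<and> y \<in> Y" for x t y
  proof -
    have q: "((x, t), y) \<in> Q" using that by (auto simp: Q_def dist_real_def abs_minus_commute)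
    then have "((x, t), y) \<in> W" using \<open>Q \<subseteq> V\<close> by (auto simp: V_def)
    then show ?thesis using z0(2)[OF q] z1(2)[OF q] by (auto simp: W_def A_def f_def H_def)
  qed
  moreover have "0 < H z0" using z0(1) \<open>Q \<subseteq> V\<close> by (auto simp: V_def)
  ultimately show ?thesis using e by blast
qed

section \<open>The dichotomy at the origin\<close>

theorem theorem1p11:
  fixes \<Omega> U :: "(real ^ 'n) set"
    and u v :: "real ^ 'n \<Rightarrow> real"
    and \<phi> \<xi> \<psi> :: "real \<Rightarrow> real"
    and I :: "real set"
    and \<epsilon>4 :: real
  assumes dim: "CARD('n) \<ge> 2"
    and Omega: "open \<Omega>" "bounded \<Omega>" "0 \<in> \<Omega>"
    and u_cont: "continuous_on (\<Omega> - {0}) u"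
    and v_C1: "open U" "closure \<Omega> \<subseteq> U" "Ck_on 1 v U"
    and v_pos: "\<And>x. x \<in> closure \<Omega> \<Longrightarrow> v x > 0"
    and u_super: "laplacian_nonpos_distr_on u (\<Omega> - {0})"
    and u_ge_v: "\<And>x. x \<in> \<Omega> - {0} \<Longrightarrow> u x \<ge> v x"
    and near_1: "open I" "1 \<in> I"
      "\<phi> C1_differentiable_on I" "\<xi> C1_differentiable_on I" "\<psi> C1_differentiable_on I"
    and at_1: "\<phi> 1 = 1" "\<xi> 1 = 1" "\<psi> 1 = 0"
    and deriv_1: "deriv \<phi> 1 + deriv \<xi> 1 > 0"
    and deriv_Phi: "\<And>y. y \<in> closure \<Omega> \<Longrightarrow>
      deriv \<phi> 1 * v y + deriv \<xi> 1 * (gradient v y \<bullet> y) + deriv \<psi> 1 > 0"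
    and eps4: "\<epsilon>4 > 0"
    and touching: "\<And>x lam. \<lbrakk>norm x < \<epsilon>4; \<bar>lam - 1\<bar> < \<epsilon>4;
        (INF y\<in>\<Omega> - {0}. ereal (u y - Phi \<phi> \<xi> \<psi> v x lam y)) = 0\<rbrakk>
      \<Longrightarrow> Liminf (at 0) (\<lambda>y. ereal (u y - Phi \<phi> \<xi> \<psi> v x lam y)) = 0"
  shows "Liminf (at 0) (\<lambda>x. ereal (u x - v x)) > 0 \<or>
    (\<exists>r>0. \<forall>x. 0 < norm x \<and> norm x < r \<longrightarrow> u x = v x \<and> v x = v 0)"
proof (cases "Liminf (at 0) (\<lambda>x. ereal (u x - v x)) > 0")
  case False
  note approach_v = Liminf_nonpos_approach[OF False]
  have dimD: "2 \<le> DIM(real ^ 'n)" using dim by simp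
  define Y where "Y = closure \<Omega>"
  have Y: "compact Y" "Y \<noteq> {}" "\<Omega> \<subseteq> Y" "Y \<subseteq> U" "0 \<in> Y"
    using Omega v_C1 closure_subset[of \<Omega>] by (auto simp: Y_def)
  have "0 < Phi_rate \<phi> \<xi> \<psi> v 0 1 y" if "y \<in> Y" for y
    using deriv_Phi[of y] that by (simp add: Phi_rate_def at_1 Y_def)
  then obtain e1 c C where e1: "e1 > 0" "c > 0" and rate:
    "\<And>x t y. norm x \<le> e1 \<Longrightarrow> \<bar>t - 1\<bar> \<le> e1 \<Longrightarrow> y \<in> Y \<Longrightarrow> t \<in> I \<and> x + \<xi> t *\<^sub>R y \<in> U \<and>
       c \<le> Phi_rate \<phi> \<xi> \<psi> v x t y \<and> Phi_rate \<phi> \<xi> \<psi> v x t y \<le> C"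
    using Phi_rate_uniformly_positive[OF Y(1,2) v_C1(1) Y(4) v_C1(3) near_1 at_1(2)] by blast
  \<comment> \<open>The factor by which \<open>Phi\<close> scales the gradient of \<open>v\<close> at \<open>y = 0\<close>.\<close>
  define q where "q = (\<lambda>t. \<phi> t * \<xi> t)"
  define q' where "q' = (\<lambda>t. \<phi> t * deriv \<xi> t + deriv \<phi> t * \<xi> t)"
  note C1 = C1_differentiable_deriv[OF near_1(3)] C1_differentiable_deriv[OF near_1(4)]
  have q_deriv: "(q has_real_derivative q' t) (at t)" if "t \<in> I" for t
    unfolding q_def q'_def using DERIV_mult'[OF C1(1)[OF that] C1(4)[OF that]] .
  have q_cont: "continuous_on I q" "continuous_on I q'"
    unfolding q_def q'_def by (intro continuous_intros C1)+
  have "open (I \<inter> q -` {0<..})" "open (I \<inter> q' -` {0<..})"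
    using q_cont near_1(1) by (auto intro: continuous_open_preimage)
  then have "open ((I \<inter> q -` {0<..}) \<inter> (I \<inter> q' -` {0<..}))" by (rule open_Int)
  moreover have "1 \<in> (I \<inter> q -` {0<..}) \<inter> (I \<inter> q' -` {0<..})"
    using near_1(2) at_1 deriv_1 by (simp add: q_def q'_def add.commute)
  ultimately obtain e2 where e2: "e2 > 0"
    "cball 1 e2 \<subseteq> (I \<inter> q -` {0<..}) \<inter> (I \<inter> q' -` {0<..})"
    by (meson open_contains_cball)
  have q_pos: "t \<in> I" "0 < q t" "0 < q' t" if "\<bar>t - 1\<bar> \<le> e2" for t
    using e2(2) that by (auto simp: subset_eq dist_real_def abs_minus_commute)
  have q_mono: "q s < q t" if "s < t" "\<bar>s - 1\<bar> \<le> e2" "\<bar>t - 1\<bar> \<le> e2" for s t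
  proof (rule DERIV_pos_imp_increasing[OF that(1)])
    fix z assume "s \<le> z" "z \<le> t"
    then have "\<bar>z - 1\<bar> \<le> e2" using that by (simp add: abs_le_iff)
    then show "\<exists>D. (q has_real_derivative D) (at z) \<and> 0 < D" using q_pos q_deriv by blast
  qed
  define e where "e = min e1 (min e2 (\<epsilon>4 / 2))"
  have e: "0 < e" "e \<le> e1" "e \<le> e2" "e < \<epsilon>4" using e1 e2 eps4 by (auto simp: e_def min_def)
  \<comment> \<open>The parameter derivative lies between \<open>c > 0\<close> and \<open>C\<close>.\<close>
  have Phi_mono: "c * (t - s) \<le> Phi \<phi> \<xi> \<psi> v x t y - Phi \<phi> \<xi> \<psi> v x s y \<and>
      Phi \<phi> \<xi> \<psi> v x t y - Phi \<phi> \<xi> \<psi> v x s y \<le> C * (t - s)"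
    if "norm x \<le> e" "1 - e \<le> s" "s \<le> t" "t \<le> 1 + e" "y \<in> Y" for x s t y
  proof (cases "s = t")
    case False
    have in_range: "\<bar>z - 1\<bar> \<le> e1" if "s \<le> z" "z \<le> t" for z
      using that \<open>1 - e \<le> s\<close> \<open>t \<le> 1 + e\<close> e by (simp add: abs_le_iff)
    have x: "norm x \<le> e1" using that e by simp
    obtain z where z: "s < z" "z < t"
      "Phi \<phi> \<xi> \<psi> v x t y - Phi \<phi> \<xi> \<psi> v x s y = (t - s) * Phi_rate \<phi> \<xi> \<psi> v x z y"
      using MVT2[of s t "\<lambda>t. Phi \<phi> \<xi> \<psi> v x t y" "\<lambda>z. Phi_rate \<phi> \<xi> \<psi> v x z y"]
        Phi_has_derivative_param[OF near_1(3-5) v_C1(3)] rate[OF x in_range \<open>y \<in> Y\<close>]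
        \<open>s \<le> t\<close> False
      by auto
    have "c \<le> Phi_rate \<phi> \<xi> \<psi> v x z y \<and> Phi_rate \<phi> \<xi> \<psi> v x z y \<le> C"
      using rate[OF x in_range[of z] \<open>y \<in> Y\<close>] z by simp
    then show ?thesis
      unfolding z(3) mult.commute[of _ "t - s"] using \<open>s \<le> t\<close>
      by (intro conjI mult_left_mono) auto
  qed simp
  have Phi_1: "Phi \<phi> \<xi> \<psi> v x 1 y = v (x + y)" for x y by (simp add: Phi_def at_1)
  define S where "S = {x + y | x y. x \<in> cball 0 e \<and> y \<in> Y}"
  have "S \<subseteq> U" using rate[of _ 1] e e1 by (force simp: S_def at_1)
  moreover have "compact S" unfolding S_def by (rule compact_sums[OF compact_cball Y(1)])
  ultimately have "uniformly_continuous_on S v"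
    using Ck1_continuous(1)[OF v_C1(3)] continuous_on_subset compact_uniformly_continuous by blast
  moreover have "0 < c * e / 2" using e e1 by simp
  ultimately obtain d0 where d0: "d0 > 0"
    "\<And>a b. a \<in> S \<Longrightarrow> b \<in> S \<Longrightarrow> dist b a < d0 \<Longrightarrow> dist (v b) (v a) < c * e / 2"
    unfolding uniformly_continuous_on_def by metis
  obtain R where R: "R > 0" "ball 0 R \<subseteq> \<Omega>" using openE[OF Omega(1,3)] .
  have dom: "dominates_subharmonic_on u (ball 0 R - {0})"
    by (rule dominates_subharmonic_subset[OF
        distributional_superharmonic_dominates[OF open_delete[OF Omega(1)] u_cont u_super]])
      (use R(2) in blast)
  have u_ge: "v y \<le> u y" if "y \<noteq> 0" "norm y < R" for y
    using u_ge_v[of y] that R(2) by (auto simp: subset_eq)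
  have v_deriv: "(v has_derivative (\<lambda>h. gradient v x \<bullet> h)) (at x)" if "x \<in> \<Omega>" for x
    using Ck1_has_gradient[OF v_C1(3)] Y(3,4) that by blast
  define d where "d = min R (min d0 e)"
  have d: "0 < d" "d \<le> R" "d \<le> d0" "d \<le> e" using R d0 e by (auto simp: d_def)
  have in_Omega: "x \<in> \<Omega>" if "norm x < d" for x using that d R(2) by (auto simp: subset_eq)
  \<comment> \<open>At the last admissible parameter contact happens at the origin, and there to first order.\<close>
  have critical: "\<exists>t. \<bar>t - 1\<bar> \<le> e \<and> Phi \<phi> \<xi> \<psi> v x t 0 = v 0 \<and> q t *\<^sub>R gradient v x = gradient v 0"
    if x: "norm x < d" for x
  proof -
    have xe: "norm x \<le> e" using x d by simp
    have close: "\<bar>v (x + y) - v y\<bar> < c * e / 2" if "y \<in> Y" for y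
    proof -
      have S: "z + y \<in> S" if "norm z \<le> e" for z
        unfolding S_def using that \<open>y \<in> Y\<close> by auto
      have "x + y \<in> S" using S[OF xe] .
      moreover have "y \<in> S" using S[of 0] e by simp
      ultimately show ?thesis using d0(2)[of y "x + y"] x d by (simp add: dist_real_def dist_norm)
    qed
    let ?F = "\<lambda>t y. Phi \<phi> \<xi> \<psi> v x t y"
    have "\<exists>t. 1 - e \<le> t \<and> t \<le> 1 + e \<and> (\<forall>y\<in>\<Omega> - {0}. ?F t y \<le> u y) \<and>
        (\<forall>r>0. \<exists>y\<in>\<Omega> - {0}. u y < ?F t y + r)"
    proof (rule maximal_parameter_below)
      show "1 - e \<le> 1 + e" using e by simp
      show "?F t y - ?F s y \<le> C * (t - s)"
        if "1 - e \<le> s" "s \<le> t" "t \<le> 1 + e" "y \<in> \<Omega> - {0}" for s t y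
        using Phi_mono[OF xe that(1-3)] that(4) Y(3) by blast
      show "?F (1 - e) y \<le> u y" if y: "y \<in> \<Omega> - {0}" for y
      proof -
        have "y \<in> Y" using y Y(3) by blast
        then have "c * e \<le> v (x + y) - ?F (1 - e) y"
          using Phi_mono[OF xe, of "1 - e" 1 y] e by (simp add: Phi_1)
        moreover have "v (x + y) - v y < c * e / 2" using close[OF \<open>y \<in> Y\<close>] unfolding abs_less_iff by simp
        ultimately show ?thesis using u_ge_v[OF y] \<open>0 < c * e / 2\<close> by linarith
      qed
      obtain y where y: "y \<noteq> 0" "norm y < R" "u y - v y < c * e / 2"
        using approach_v[OF \<open>0 < c * e / 2\<close> R(1)] by blast
      then have yO: "y \<in> \<Omega> - {0}" using R(2) by (auto simp: subset_eq)
      then have "y \<in> Y" using Y(3) by blast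
      then have "c * e \<le> ?F (1 + e) y - v (x + y)"
        using Phi_mono[OF xe, of 1 "1 + e" y] e by (simp add: Phi_1)
      moreover have "v y - v (x + y) < c * e / 2" using close[OF \<open>y \<in> Y\<close>] unfolding abs_less_iff by simp
      ultimately have "u y < ?F (1 + e) y" using y(3) by linarith
      then show "\<exists>y\<in>\<Omega> - {0}. u y < ?F (1 + e) y" using yO by blast
    qed
    then obtain t where t: "1 - e \<le> t" "t \<le> 1 + e" "\<And>y. y \<in> \<Omega> - {0} \<Longrightarrow> ?F t y \<le> u y"
      "\<And>r. r > 0 \<Longrightarrow> \<exists>y\<in>\<Omega> - {0}. u y < ?F t y + r" by blast
    have "(INF y\<in>\<Omega> - {0}. ereal (u y - ?F t y)) = 0"
    proof (rule INF_ereal_eq_0)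
      show "0 \<le> u y - ?F t y" if "y \<in> \<Omega> - {0}" for y using t(3)[OF that] by simp
      show "\<exists>y\<in>\<Omega> - {0}. u y - ?F t y < r" if "r > 0" for r
        using t(4)[OF that] by (auto simp: diff_less_eq add.commute)
    qed
    then have "Liminf (at 0) (\<lambda>y. ereal (u y - ?F t y)) = 0"
      using t(1,2) xe e by (intro touching) auto
    then have approach: "\<exists>y. y \<noteq> 0 \<and> norm y < r \<and> u y < ?F t y + s" if "s > 0" "r > 0" for r s
      using Liminf_nonpos_approach[of "\<lambda>y. u y - ?F t y", OF _ that]
      by (auto simp: diff_less_eq add.commute)
    have approach_v': "\<exists>y. y \<noteq> 0 \<and> norm y < r \<and> u y < v y + s" if "s > 0" "r > 0" for r s
      using approach_v[OF that] by (auto simp: diff_less_eq add.commute)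
    have F_le: "?F t y \<le> u y" if "y \<noteq> 0" "norm y < R" for y
      using t(3)[of y] that R(2) by (auto simp: subset_eq)
    have xU: "x \<in> U" using in_Omega[OF x] Y by blast
    note F_deriv = Phi_has_derivative_space[OF v_C1(3) xU, of \<phi> \<xi> \<psi> t]
    note cont = has_derivative_continuous[OF F_deriv] has_derivative_continuous[OF v_deriv[OF Omega(3)]]
    have eq: "?F t 0 = v 0"
      using common_limit_of_minorants[OF cont(1,2) R(1) F_le approach_v']
        common_limit_of_minorants[OF cont(2,1) R(1) u_ge approach] by (rule antisym)
    have "(\<phi> t * \<xi> t) *\<^sub>R gradient v x = gradient v 0"
      by (rule minorant_gradients_agree[OF dimD R(1) dom F_deriv F_le v_deriv[OF Omega(3)] u_ge approach eq])
    then show ?thesis using eq t(1,2) by (intro exI[of _ t]) (auto simp: q_def abs_le_iff)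
  qed
  \<comment> \<open>Since \<open>Phi\<close> increases in the parameter from \<open>v x\<close> at \<open>t = 1\<close> and equals \<open>v 0\<close> at the
    critical parameter, the sign of \<open>v 0 - v x\<close> is that of \<open>t - 1\<close>, hence that of \<open>q t - 1\<close>.\<close>
  have tangent: "\<exists>P>0. P *\<^sub>R gradient v x = gradient v 0 \<and> (v x > v 0 \<longrightarrow> P < 1) \<and> (v x < v 0 \<longrightarrow> P > 1)"
    if x: "norm x < d" for x
  proof -
    obtain t where t: "\<bar>t - 1\<bar> \<le> e" "Phi \<phi> \<xi> \<psi> v x t 0 = v 0" "q t *\<^sub>R gradient v x = gradient v 0"
      using critical[OF x] by blast
    have t': "1 - e \<le> t" "t \<le> 1 + e" "\<bar>t - 1\<bar> \<le> e2" using t(1) e by (auto simp: abs_le_iff)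
    have q1: "q 1 = 1" by (simp add: q_def at_1)
    have xe: "norm x \<le> e" using x d by simp
    have "q t < 1" if "v x > v 0"
    proof -
      have "t < 1"
      proof (rule ccontr)
        assume "\<not> t < 1"
        then have "c * (t - 1) \<le> v 0 - v x"
          using Phi_mono[OF xe, of 1 t 0] t' t(2) e Y(5) Phi_1[of x 0] by simp
        moreover have "0 \<le> c * (t - 1)" using \<open>\<not> t < 1\<close> e1 by simp
        ultimately show False using that by simp
      qed
      then show ?thesis using q_mono[of t 1] t' e2 q1 by simp
    qed
    moreover have "q t > 1" if "v x < v 0"
    proof -
      have "1 < t"
      proof (rule ccontr)
        assume "\<not> 1 < t"
        then have "c * (1 - t) \<le> v x - v 0"
          using Phi_mono[OF xe, of t 1 0] t' t(2) e Y(5) Phi_1[of x 0] by simp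
        moreover have "0 \<le> c * (1 - t)" using \<open>\<not> 1 < t\<close> e1 by simp
        ultimately show False using that by simp
      qed
      then show ?thesis using q_mono[of 1 t] t' e2 q1 by simp
    qed
    ultimately show ?thesis using q_pos(2)[OF t'(3)] t(3) by blast
  qed
  define p where "p = gradient v 0"
  have above: "v 0 + p \<bullet> y \<le> v y" "p \<bullet> y \<noteq> 0 \<Longrightarrow> v 0 + p \<bullet> y < v y" if "norm y < d" for y
    using above_tangent_plane[of d v "gradient v" p y, OF v_deriv[OF in_Omega] tangent[folded p_def] that]
    by blast+
  have u_affine: "u y = v 0 + p \<bullet> y" if y: "y \<noteq> 0" "norm y < d" for y
  proof -
    have sub: "ball 0 d - {0} \<subseteq> ball (0 :: real ^ 'n) R - {0}" using d by auto
    have "u y - (v 0 + p \<bullet> y) = 0"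
    proof (rule punctured_ball_rigidity[OF dimD d(1)])
      show "dominates_subharmonic_on (\<lambda>y. u y - (v 0 + p \<bullet> y)) (ball 0 d - {0})"
        by (rule dominates_subharmonic_diff_affine[OF dominates_subharmonic_subset[OF dom sub]])
      have "ball 0 d - {0} \<subseteq> \<Omega> - {0}" using sub R(2) by blast
      then show "continuous_on (ball 0 d - {0}) (\<lambda>y. u y - (v 0 + p \<bullet> y))"
        using u_cont by (intro continuous_intros) (auto intro: continuous_on_subset)
      show "0 \<le> u y - (v 0 + p \<bullet> y)" if "y \<in> ball 0 d - {0}" for y
        using above(1)[of y] u_ge[of y] that d by simp
      show "y \<in> ball 0 d - {0}" using y by simp
      fix s r :: real assume sr: "s > 0" "r > 0"
      have "isCont (\<lambda>y. v y - (v 0 + p \<bullet> y)) 0"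
        using has_derivative_continuous[OF v_deriv[OF Omega(3)]] by (intro continuous_intros)
      then have "\<exists>k>0. \<forall>y. dist y 0 < k \<longrightarrow> dist (v y - (v 0 + p \<bullet> y)) (v 0 - (v 0 + p \<bullet> 0)) < s / 2"
        using half_gt_zero[OF sr(1)] unfolding continuous_at_eps_delta by blast
      then obtain k where k: "k > 0" "\<And>y. norm y < k \<Longrightarrow> \<bar>v y - (v 0 + p \<bullet> y)\<bar> < s / 2"
        by (auto simp: dist_real_def)
      obtain y where y: "y \<noteq> 0" "norm y < min k r" "u y - v y < s / 2"
        using approach_v[of "s / 2" "min k r"] sr k by auto
      have "v y - (v 0 + p \<bullet> y) < s / 2" using k(2)[of y] y(2) unfolding abs_less_iff by simp
      then have "u y - (v 0 + p \<bullet> y) < s" using y(3) by linarith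
      then show "\<exists>y. y \<noteq> 0 \<and> norm y < r \<and> u y - (v 0 + p \<bullet> y) < s" using y by auto
    qed
    then show ?thesis by simp
  qed
  have "p = 0"
  proof (rule ccontr)
    assume "p \<noteq> 0"
    define y where "y = (d / (2 * norm p)) *\<^sub>R p"
    have y: "y \<noteq> 0" "norm y < d" "p \<bullet> y \<noteq> 0" using \<open>p \<noteq> 0\<close> d(1) by (auto simp: y_def)
    then have "v 0 + p \<bullet> y < v y" using above(2) by blast
    also have "v y \<le> u y" using u_ge[OF y(1)] y(2) d by simp
    finally show False using u_affine[OF y(1,2)] by simp
  qed
  have "u y = v y \<and> v y = v 0" if "0 < norm y" "norm y < d" for y
    using u_affine[of y] above(1)[of y] u_ge[of y] that d \<open>p = 0\<close> by simp
  then show ?thesis using d(1) by blast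
qed simp

end
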